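(* Let $C_0$ and $C_1$ be compact contractible topological $n$-manifolds, where $n\geq 2$. Then $\operatorname{int}(C_0)$ and $\operatorname{int}(C_1)$ are properly homotopy equivalent if and only if $\partial C_0$ and $\partial C_1$ are homotopy equivalent.
   Context: A continuous map between locally compact Hausdorff spaces is proper if preimages of compact sets are compact. Two such spaces are properly homotopy equivalent if there are proper maps in both directions whose composites are homotopic to the identities through proper homotopies (homotopies that are proper as maps from the product with $[0,1]$). *)

theory Defs
  imports "HOL-Analysis.Analysis"
begin

text \<open>The restriction is on the coordinate with index \<open>0\<close>, so this is the usual closed half-space
  of the \<open>n\<close>-dimensional Euclidean space only for \<open>n \<ge> 1\<close>; for \<open>n = 0\<close> it is a point.\<close>

definition Euclidean_halfspace :: "nat \<Rightarrow> (nat \<Rightarrow> real) topology" where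
  "Euclidean_halfspace n = subtopology (Euclidean_space n) {x. 0 \<le> x 0}"

text \<open>A manifold may have a boundary, possibly empty.\<close>

definition topological_manifold :: "nat \<Rightarrow> 'a topology \<Rightarrow> bool" where
  "topological_manifold n X \<longleftrightarrow>
     Hausdorff_space X \<and> second_countable X \<and>
     (\<forall>x \<in> topspace X. \<exists>U V. openin X U \<and> x \<in> U \<and> openin (Euclidean_halfspace n) V \<and>
        subtopology X U homeomorphic_space subtopology (Euclidean_halfspace n) V)"

definition manifold_interior :: "nat \<Rightarrow> 'a topology \<Rightarrow> 'a set" where
  "manifold_interior n X =
     {x \<in> topspace X. \<exists>U V. openin X U \<and> x \<in> U \<and> openin (Euclidean_space n) V \<and>
        subtopology X U homeomorphic_space subtopology (Euclidean_space n) V}"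

definition manifold_boundary :: "nat \<Rightarrow> 'a topology \<Rightarrow> 'a set" where
  "manifold_boundary n X = topspace X - manifold_interior n X"

text \<open>The library's \<^const>\<open>proper_map\<close> means a closed map, not necessarily continuous, with compact
  fibres. Here a proper map is continuous and pulls compact sets back to compact sets;
  on locally compact Hausdorff spaces the two agree for continuous maps.\<close>

definition proper_continuous_map :: "'a topology \<Rightarrow> 'b topology \<Rightarrow> ('a \<Rightarrow> 'b) \<Rightarrow> bool" where
  "proper_continuous_map X Y f \<longleftrightarrow>
     continuous_map X Y f \<and>
     (\<forall>K. compactin Y K \<longrightarrow> compactin X {x \<in> topspace X. f x \<in> K})"

text \<open>The homotopy must be proper as a map on the product, which is stronger than each of its
  stages being proper; hence this is not an instance of \<^const>\<open>homotopic_with\<close>.\<close>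

definition properly_homotopic ::
    "'a topology \<Rightarrow> 'b topology \<Rightarrow> ('a \<Rightarrow> 'b) \<Rightarrow> ('a \<Rightarrow> 'b) \<Rightarrow> bool" where
  "properly_homotopic X Y f g \<longleftrightarrow>
     (\<exists>h. proper_continuous_map (prod_topology (top_of_set {0..1::real}) X) Y h \<and>
        (\<forall>x \<in> topspace X. h (0, x) = f x) \<and>
        (\<forall>x \<in> topspace X. h (1, x) = g x))"

definition properly_homotopy_equivalent_space :: "'a topology \<Rightarrow> 'b topology \<Rightarrow> bool" where
  "properly_homotopy_equivalent_space X Y \<longleftrightarrow>
     (\<exists>f g. proper_continuous_map X Y f \<and> proper_continuous_map Y X g \<and>
        properly_homotopic X X (g \<circ> f) id \<and> properly_homotopic Y Y (f \<circ> g) id)"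

end

theory Submission
  imports Defs "HOL-Homology.Invariance_of_Domain"
begin

text \<open>The boundary \<open>B\<close> of a compact manifold \<open>X\<close> has a collar, so the interior is homeomorphic to
  \<open>X\<close> with an open cylinder \<open>B \<times> [0,1)\<close> attached along \<open>B\<close>. A proper homotopy equivalence between two
  such spaces carries far slices \<open>B \<times> {s}\<close> into the other cylinder and so induces a homotopy
  equivalence of the bases. Conversely, a map of bases gives a map of cylinders, which extends to the
  whole space because the target is contractible: cone it off away from the end. The same
  coning shows that the proper homotopy class depends only on the germ at the end. This
  argument also covers empty boundaries, so it never needs the fact that a compact contractible
  manifold of positive dimension has non-empty boundary.

  The collar is obtained by attaching an external collar and absorbing it into \<open>X\<close> one
  coordinate chart at a time.\<close>

section \<open>Proper homotopy\<close>

text \<open>What happens near the end is read off from one real coordinate, the height in the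
  cylinder: heights bounded away from 1 form a compact set, and every compact set has such a bound.
  Proper maps do not respect this coordinate; the slice at one height may land at varying heights.
  What survives is positivity, since a point of positive height lies over the base. Slices are
  therefore taken so far out that the maps, the homotopies and the sliding of all heights to a
  common one avoid height 0. Conversely, a map of bases has no reason to extend over the inner part.
  Contractibility supplies the extension: a contraction of the target is run for a time that depends
  on the height, from not at all far out to completely further in. For the collar, the height of the
  external cylinder is a function on the base, so that its growth from 0 to 1 splits into finitely
  many steps, each supported in one chart. That the face of a half-space chart is the boundary,
  which is defined as the set of points without Euclidean charts, rests on invariance of
  domain.\<close>

abbreviation unit_interval :: "real topology" where
  "unit_interval \<equiv> top_of_set {0..1}"

lemma properly_homotopic_trans:
  assumes "properly_homotopic X Y f g" "properly_homotopic X Y g k"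
  shows "properly_homotopic X Y f k"
proof -
  let ?P = "prod_topology unit_interval X"
  obtain h1 where c1: "continuous_map ?P Y h1"
    and p1: "\<And>K. compactin Y K \<Longrightarrow> compactin ?P {z \<in> topspace ?P. h1 z \<in> K}"
    and h1: "\<And>x. x \<in> topspace X \<Longrightarrow> h1 (0,x) = f x" "\<And>x. x \<in> topspace X \<Longrightarrow> h1 (1,x) = g x"
    using assms(1) unfolding properly_homotopic_def proper_continuous_map_def by blast
  obtain h2 where c2: "continuous_map ?P Y h2"
    and p2: "\<And>K. compactin Y K \<Longrightarrow> compactin ?P {z \<in> topspace ?P. h2 z \<in> K}"
    and h2: "\<And>x. x \<in> topspace X \<Longrightarrow> h2 (0,x) = g x" "\<And>x. x \<in> topspace X \<Longrightarrow> h2 (1,x) = k x"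
    using assms(2) unfolding properly_homotopic_def proper_continuous_map_def by blast
  define h where "h z = (if fst z \<le> 1/2 then h1 (2 * fst z, snd z) else h2 (2 * fst z - 1, snd z))"
    for z
  have fstc: "continuous_map (subtopology ?P S) euclideanreal fst" for S
    by (metis continuous_map_fst continuous_map_from_subtopology continuous_map_into_fulltopology)
  have sndc: "continuous_map (subtopology ?P S) X snd" for S
    by (metis continuous_map_snd continuous_map_from_subtopology)
  have "continuous_map ?P Y h"
    unfolding h_def
  proof (rule continuous_map_cases_le)
    show "continuous_map ?P euclideanreal fst" "continuous_map ?P euclideanreal (\<lambda>x. 1/2)"
      using fstc[of UNIV] by auto
    show "continuous_map (subtopology ?P {z \<in> topspace ?P. fst z \<le> 1/2}) Y
            (\<lambda>z. h1 (2 * fst z, snd z))"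
      by (rule continuous_map_compose[OF _ c1, unfolded o_def])
        (auto intro!: continuous_intros fstc sndc simp: continuous_map_in_subtopology)
    show "continuous_map (subtopology ?P {z \<in> topspace ?P. 1/2 \<le> fst z}) Y
            (\<lambda>z. h2 (2 * fst z - 1, snd z))"
      by (rule continuous_map_compose[OF _ c2, unfolded o_def])
        (auto intro!: continuous_intros fstc sndc simp: continuous_map_in_subtopology)
    show "h1 (2 * fst z, snd z) = h2 (2 * fst z - 1, snd z)"
      if "z \<in> topspace ?P" "fst z = 1/2" for z
    proof -
      have "2 * fst z = 1" "snd z \<in> topspace X"
        using that by (auto simp: mem_Times_iff)
      then show ?thesis
        using h1(2) h2(1) by simp
    qed
  qed
  moreover have "compactin ?P {z \<in> topspace ?P. h z \<in> K}" if K: "compactin Y K" for K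
  proof -
    let ?a = "\<lambda>z::real \<times> 'a. (fst z / 2, snd z)" and ?b = "\<lambda>z::real \<times> 'a. (fst z / 2 + 1/2, snd z)"
    have fst0: "continuous_map ?P euclideanreal fst"
      using fstc[of UNIV] by auto
    have a: "continuous_map ?P ?P ?a" and b: "continuous_map ?P ?P ?b"
      by (auto intro!: continuous_intros fst0 simp: continuous_map_in_subtopology)
    \<comment> \<open>The maps \<open>?a\<close> and \<open>?b\<close> squeeze the unit interval
      into its two halves; compactness of the two preimages passes to their images.\<close>
    have "{z \<in> topspace ?P. h z \<in> K} =
        ?a ` {z \<in> topspace ?P. h1 z \<in> K} \<union> ?b ` {z \<in> topspace ?P. h2 z \<in> K}" (is "?L = ?R")
    proof (intro subset_antisym subsetI)
      fix z assume z: "z \<in> ?L"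
      show "z \<in> ?R"
      proof (cases "fst z \<le> 1/2")
        case True
        then show ?thesis
          using z by (intro UnI1 image_eqI[where x = "(2 * fst z, snd z)"]) (auto simp: h_def)
      next
        case False
        then show ?thesis
          using z by (intro UnI2 image_eqI[where x = "(2 * fst z - 1, snd z)"]) (auto simp: h_def field_simps)
      qed
    next
      fix z assume "z \<in> ?R"
      then show "z \<in> ?L"
      proof
        assume "z \<in> ?a ` {z \<in> topspace ?P. h1 z \<in> K}"
        then show ?thesis by (auto simp: h_def)
      next
        assume "z \<in> ?b ` {z \<in> topspace ?P. h2 z \<in> K}"
        then obtain u x where z: "z = (u / 2 + 1/2, x)" "0 \<le> u" "u \<le> 1" "x \<in> topspace X" "h2 (u,x) \<in> K"
          by auto
        \<comment> \<open>For \<open>u = 0\<close> the first coordinate of \<open>z\<close> is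
          \<open>1/2\<close>, where \<open>h\<close> follows \<open>h1\<close>. Both homotopies give
          \<open>g x\<close> there.\<close>
        then have "h z = h2 (u, x)"
          using h1(2)[of x] h2(1)[of x] by (cases "u = 0") (auto simp: h_def)
        then show ?thesis
          using z by auto
      qed
    qed
    then show ?thesis
      using image_compactin[OF p1[OF K] a] image_compactin[OF p2[OF K] b]
      by (simp add: compactin_Un)
  qed
  ultimately have "proper_continuous_map ?P Y h"
    by (simp add: proper_continuous_map_def)
  then show ?thesis
    unfolding properly_homotopic_def using h1 h2
    by (intro exI[of _ h]) (auto simp: h_def)
qed

lemma proper_continuous_map_compose:
  assumes "proper_continuous_map X Y f" "proper_continuous_map Y Z g"
  shows "proper_continuous_map X Z (g \<circ> f)"
  unfolding proper_continuous_map_def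
proof (intro conjI allI impI)
  show "continuous_map X Z (g \<circ> f)"
    using assms by (auto simp: proper_continuous_map_def intro: continuous_map_compose)
  fix K assume "compactin Z K"
  then have "compactin X {x \<in> topspace X. f x \<in> {y \<in> topspace Y. g y \<in> K}}"
    using assms by (auto simp: proper_continuous_map_def)
  moreover have "f x \<in> topspace Y" if "x \<in> topspace X" for x
    using assms that by (auto simp: proper_continuous_map_def continuous_map_def)
  ultimately show "compactin X {x \<in> topspace X. (g \<circ> f) x \<in> K}"
    by (smt (verit) Collect_cong comp_apply mem_Collect_eq)
qed

lemma homeomorphic_maps_imp_proper:
  assumes "homeomorphic_maps X Y f g"
  shows "proper_continuous_map X Y f"
  unfolding proper_continuous_map_def
proof (intro conjI allI impI)
  show "continuous_map X Y f"
    using assms by (simp add: homeomorphic_maps_def)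
  fix K assume K: "compactin Y K"
  have "compactin X (g ` K)"
    using assms K by (auto simp: homeomorphic_maps_def intro: image_compactin)
  moreover have "{x \<in> topspace X. f x \<in> K} = g ` K"
  proof (intro subset_antisym subsetI)
    fix x assume x: "x \<in> {x \<in> topspace X. f x \<in> K}"
    then have "x = g (f x)"
      using assms by (simp add: homeomorphic_maps_def)
    then show "x \<in> g ` K"
      using x by blast
  next
    fix x assume "x \<in> g ` K"
    then obtain y where y: "y \<in> K" "x = g y" by blast
    then have "y \<in> topspace Y"
      using compactin_subset_topspace[OF K] by blast
    then show "x \<in> {x \<in> topspace X. f x \<in> K}"
      using assms y by (auto simp: homeomorphic_maps_def continuous_map_def)
  qed
  ultimately show "compactin X {x \<in> topspace X. f x \<in> K}"
    by simp
qed

text \<open>The homotopy is conjugated together with the map. \<open>f'\<close> is described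
  pointwise on \<open>topspace Y\<close> because, in the application, mutually inverse maps inside a
  composite cancel only on the spaces.\<close>

lemma properly_homotopic_conjugate:
  assumes F: "homeomorphic_maps X Y a b" and h: "properly_homotopic X X f id"
    and f': "\<And>y. y \<in> topspace Y \<Longrightarrow> f' y = a (f (b y))"
  shows "properly_homotopic Y Y f' id"
proof -
  obtain h where h: "proper_continuous_map (prod_topology unit_interval X) X h"
    "\<forall>x \<in> topspace X. h (0, x) = f x" "\<forall>x \<in> topspace X. h (1, x) = id x"
    using h by (auto simp: properly_homotopic_def)
  have "homeomorphic_maps (prod_topology unit_interval Y) (prod_topology unit_interval X)
     (\<lambda>(u,y). (id u, b y)) (\<lambda>(u,x). (id u, a x))"
    using F unfolding homeomorphic_maps_prod by (metis homeomorphic_maps_id homeomorphic_maps_sym)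
  then have p: "proper_continuous_map (prod_topology unit_interval Y) (prod_topology unit_interval X)
     (\<lambda>(u,y). (id u, b y))"
    by (rule homeomorphic_maps_imp_proper)
  have "proper_continuous_map (prod_topology unit_interval Y) Y (a \<circ> (h \<circ> (\<lambda>(u,y). (id u, b y))))"
    using proper_continuous_map_compose[OF proper_continuous_map_compose[OF p h(1)]
        homeomorphic_maps_imp_proper[OF F]] .
  moreover have "b y \<in> topspace X" "a (b y) = y" if "y \<in> topspace Y" for y
    using F that by (auto simp: homeomorphic_maps_def continuous_map_def)
  ultimately show ?thesis
    unfolding properly_homotopic_def using h f'
    by (intro exI[of _ "a \<circ> (h \<circ> (\<lambda>(u,y). (id u, b y)))"]) auto
qed

lemma properly_homotopy_equivalent_space_homeomorphic:
  assumes "X homeomorphic_space X'" "Y homeomorphic_space Y'"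
    and "properly_homotopy_equivalent_space X Y"
  shows "properly_homotopy_equivalent_space X' Y'"
proof -
  obtain a b where ab: "homeomorphic_maps X X' a b"
    using assms(1) by (auto simp: homeomorphic_space_def)
  obtain c d where cd: "homeomorphic_maps Y Y' c d"
    using assms(2) by (auto simp: homeomorphic_space_def)
  obtain f g where f: "proper_continuous_map X Y f" and g: "proper_continuous_map Y X g"
    and gf: "properly_homotopic X X (g \<circ> f) id" and fg: "properly_homotopic Y Y (f \<circ> g) id"
    using assms(3) by (auto simp: properly_homotopy_equivalent_space_def)
  have ba: "homeomorphic_maps X' X b a" and dc: "homeomorphic_maps Y' Y d c"
    using ab cd homeomorphic_maps_sym by blast+
  have "proper_continuous_map X' Y' (c \<circ> (f \<circ> b))" "proper_continuous_map Y' X' (a \<circ> (g \<circ> d))"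
    using ab ba cd dc f g by (blast intro: proper_continuous_map_compose homeomorphic_maps_imp_proper)+
  moreover have "properly_homotopic X' X' ((a \<circ> (g \<circ> d)) \<circ> (c \<circ> (f \<circ> b))) id"
  proof (rule properly_homotopic_conjugate[OF ab gf])
    fix y assume "y \<in> topspace X'"
    then have "f (b y) \<in> topspace Y"
      using ab f by (auto simp: homeomorphic_maps_def proper_continuous_map_def continuous_map_def)
    then show "((a \<circ> (g \<circ> d)) \<circ> (c \<circ> (f \<circ> b))) y = a ((g \<circ> f) (b y))"
      using cd by (simp add: homeomorphic_maps_def)
  qed
  moreover have "properly_homotopic Y' Y' ((c \<circ> (f \<circ> b)) \<circ> (a \<circ> (g \<circ> d))) id"
  proof (rule properly_homotopic_conjugate[OF cd fg])
    fix y assume "y \<in> topspace Y'"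
    then have "g (d y) \<in> topspace X"
      using cd g by (auto simp: homeomorphic_maps_def proper_continuous_map_def continuous_map_def)
    then show "((c \<circ> (f \<circ> b)) \<circ> (a \<circ> (g \<circ> d))) y = c ((f \<circ> g) (d y))"
      using ab by (simp add: homeomorphic_maps_def)
  qed
  ultimately show ?thesis
    unfolding properly_homotopy_equivalent_space_def by blast
qed

section \<open>Open cylinders and their ends\<close>

text \<open>This is X with \<open>A \<times> [0,1)\<close> glued on along A, realised inside a
  product so that no quotient topology occurs: X sits at height 0, and the end is at the missing
  height 1.\<close>

definition open_cylinder :: "'a topology \<Rightarrow> 'a set \<Rightarrow> ('a \<times> real) topology" where
  "open_cylinder X A =
     subtopology (prod_topology X euclideanreal) {(x,s). 0 \<le> s \<and> s < 1 \<and> (x \<in> A \<or> s = 0)}"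

section \<open>Compactness and properness measured by the height\<close>

lemma topspace_open_cylinder:
  "topspace (open_cylinder X A) =
     {(x,s). x \<in> topspace X \<and> 0 \<le> s \<and> s < 1 \<and> (x \<in> A \<or> s = 0)}"
  by (auto simp: open_cylinder_def)

lemma continuous_map_open_cylinder_fst: "continuous_map (open_cylinder X A) X fst"
  unfolding open_cylinder_def by (rule continuous_map_from_subtopology[OF continuous_map_fst])

lemma continuous_map_open_cylinder_snd: "continuous_map (open_cylinder X A) euclideanreal snd"
  unfolding open_cylinder_def by (rule continuous_map_from_subtopology[OF continuous_map_snd])

lemma continuous_map_into_open_cylinder:
  assumes "continuous_map Z X f" "continuous_map Z euclideanreal l"
    and "\<And>z. z \<in> topspace Z \<Longrightarrow> 0 \<le> l z \<and> l z < 1 \<and> (f z \<in> A \<or> l z = 0)"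
  shows "continuous_map Z (open_cylinder X A) (\<lambda>z. (f z, l z))"
  using assms by (auto simp: open_cylinder_def continuous_map_in_subtopology intro!: continuous_intros)

lemma Hausdorff_open_cylinder: "Hausdorff_space X \<Longrightarrow> Hausdorff_space (open_cylinder X A)"
  unfolding open_cylinder_def
  by (simp add: Hausdorff_space_subtopology Hausdorff_space_prod_topology)

text \<open>These sublevel sets exhaust the cylinder. As compact sets conversely have height bounded
  below 1, properness becomes a condition on heights.\<close>

lemma compactin_open_cylinder_le:
  assumes "compact_space X" "closedin X A" "b < 1"
  shows "compactin (open_cylinder X A) {z \<in> topspace (open_cylinder X A). snd z \<le> b}"
proof (cases "0 \<le> b")
  case True
  have "{z \<in> topspace (open_cylinder X A). snd z \<le> b} = topspace X \<times> {0} \<union> A \<times> {0..b}"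
    using assms True closedin_subset[of X A] by (auto simp: topspace_open_cylinder)
  moreover have "compactin (prod_topology X euclideanreal) (topspace X \<times> {0} \<union> A \<times> {0..b})"
    using assms closedin_compact_space[of X A]
    by (auto intro!: compactin_Un simp: compactin_Times compact_space_def)
  ultimately show ?thesis
    using assms True by (auto simp: open_cylinder_def compactin_subtopology)
next
  case False
  then have "{z \<in> topspace (open_cylinder X A). snd z \<le> b} = {}"
    by (auto simp: topspace_open_cylinder)
  then show ?thesis
    by (metis compactin_empty)
qed

lemma compactin_open_cylinder_bounded:
  assumes K: "compactin (open_cylinder X A) K"
  obtains b where "0 \<le> b" "b < 1" "\<And>z. z \<in> K \<Longrightarrow> snd z \<le> b"
proof (cases "K = {}")
  case False
  have "compact (snd ` K)"
    using image_compactin[OF K continuous_map_open_cylinder_snd] by simp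
  then obtain z where z: "z \<in> K" "\<And>w. w \<in> K \<Longrightarrow> snd w \<le> snd z"
    using compact_attains_sup[of "snd ` K"] False by auto
  then show ?thesis
    using that[of "snd z"] compactin_subset_topspace[OF K] by (auto simp: topspace_open_cylinder)
qed (use that[of 0] in auto)

text \<open>A compact set lies in a sublevel set, and its preimage is closed because the target is
  Hausdorff; a closed part of a compact set is compact.\<close>

lemma proper_continuous_map_into_open_cylinder:
  assumes Y: "Hausdorff_space Y" and F: "continuous_map Z (open_cylinder Y B) F"
    and C: "\<And>b. b < 1 \<Longrightarrow> \<exists>C. compactin Z C \<and> (\<forall>z \<in> topspace Z. snd (F z) \<le> b \<longrightarrow> z \<in> C)"
  shows "proper_continuous_map Z (open_cylinder Y B) F"
  unfolding proper_continuous_map_def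
proof (intro conjI allI impI F)
  fix K assume K: "compactin (open_cylinder Y B) K"
  obtain b where b: "b < 1" "\<And>z. z \<in> K \<Longrightarrow> snd z \<le> b"
    using compactin_open_cylinder_bounded[OF K] by metis
  obtain C where "compactin Z C" "\<forall>z \<in> topspace Z. snd (F z) \<le> b \<longrightarrow> z \<in> C"
    using C[OF b(1)] by blast
  moreover have "closedin Z {z \<in> topspace Z. F z \<in> K}"
    using closedin_continuous_map_preimage[OF F]
      compactin_imp_closedin[OF Hausdorff_open_cylinder[OF Y] K] by blast
  moreover have "{z \<in> topspace Z. F z \<in> K} \<subseteq> C"
    using b(2) calculation(2) by blast
  ultimately show "compactin Z {z \<in> topspace Z. F z \<in> K}"
    using closed_compactin by blast
qed

lemma proper_continuous_map_open_cylinder: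
  assumes "compact_space X" "closedin X A" "Hausdorff_space Y" "r < 1"
    and F: "continuous_map (open_cylinder X A) (open_cylinder Y B) F"
    and lev: "\<And>z. z \<in> topspace (open_cylinder X A) \<Longrightarrow> r \<le> snd z \<Longrightarrow> snd (F z) = snd z"
  shows "proper_continuous_map (open_cylinder X A) (open_cylinder Y B) F"
proof (rule proper_continuous_map_into_open_cylinder[OF assms(3) F])
  fix b :: real assume "b < 1"
  \<comment> \<open>Above height \<open>r\<close> the map keeps heights, so a value of height at
    most \<open>b\<close> comes from height at most \<open>b\<close>; below \<open>r\<close> nothing
    is known. Hence \<open>max b r\<close>.\<close>
  then have "compactin (open_cylinder X A) {z \<in> topspace (open_cylinder X A). snd z \<le> max b r}"
    using assms by (intro compactin_open_cylinder_le) auto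
  moreover have "snd z \<le> max b r"
    if "z \<in> topspace (open_cylinder X A)" "snd (F z) \<le> b" for z
    using lev[OF that(1)] that by (cases "r \<le> snd z") auto
  ultimately show "\<exists>C. compactin (open_cylinder X A) C \<and>
      (\<forall>z \<in> topspace (open_cylinder X A). snd (F z) \<le> b \<longrightarrow> z \<in> C)"
    by blast
qed

lemma proper_continuous_map_cylinder_homotopy:
  assumes "compact_space X" "closedin X A" "Hausdorff_space Y" "r < 1"
    and F: "continuous_map (prod_topology unit_interval (open_cylinder X A)) (open_cylinder Y B) F"
    and lev: "\<And>u z. 0 \<le> u \<Longrightarrow> u \<le> 1 \<Longrightarrow> z \<in> topspace (open_cylinder X A) \<Longrightarrow> r \<le> snd z
                \<Longrightarrow> snd (F (u,z)) = snd z"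
  shows "proper_continuous_map (prod_topology unit_interval (open_cylinder X A)) (open_cylinder Y B) F"
proof (rule proper_continuous_map_into_open_cylinder[OF assms(3) F])
  let ?P = "prod_topology unit_interval (open_cylinder X A)"
  fix b :: real assume "b < 1"
  then have "compactin (open_cylinder X A) {z \<in> topspace (open_cylinder X A). snd z \<le> max b r}"
    using assms by (intro compactin_open_cylinder_le) auto
  then have "compactin ?P ({0..1} \<times> {z \<in> topspace (open_cylinder X A). snd z \<le> max b r})"
    by (simp add: compactin_Times compactin_subtopology)
  moreover have "w \<in> {0..1} \<times> {z \<in> topspace (open_cylinder X A). snd z \<le> max b r}"
    if w: "w \<in> topspace ?P" "snd (F w) \<le> b" for w
    using lev[of "fst w" "snd w"] w by (cases "r \<le> snd (snd w)") (auto simp: mem_Times_iff)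
  ultimately show "\<exists>C. compactin ?P C \<and> (\<forall>z \<in> topspace ?P. snd (F z) \<le> b \<longrightarrow> z \<in> C)"
    by blast
qed

section \<open>Coning off along a contraction\<close>

definition cutoff :: "real \<Rightarrow> real \<Rightarrow> real \<Rightarrow> real" where
  "cutoff r r' s = max 0 (min 1 ((r' - s) / (r' - r)))"

lemma cutoff_bounds: "0 \<le> cutoff r r' s" "cutoff r r' s \<le> 1"
  by (auto simp: cutoff_def)

lemma cutoff_low: "r < r' \<Longrightarrow> s \<le> r \<Longrightarrow> cutoff r r' s = 1"
  by (auto simp: cutoff_def)

lemma cutoff_high: "r < r' \<Longrightarrow> r' \<le> s \<Longrightarrow> cutoff r r' s = 0"
  by (simp add: cutoff_def divide_nonpos_pos max.absorb1 min.coboundedI2)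

lemma continuous_map_cutoff [continuous_intros]:
  "continuous_map X euclideanreal l \<Longrightarrow> r < r' \<Longrightarrow> continuous_map X euclideanreal (\<lambda>x. cutoff r r' (l x))"
  unfolding cutoff_def by (intro continuous_intros) auto

text \<open>With \<open>H\<close> a contraction to \<open>p\<close> and \<open>l\<close> a height,
  this extends a map \<open>G\<close> that is meaningful only where \<open>r \<le> l z\<close>:
  \<open>G\<close> is kept above \<open>r'\<close>, dragged towards \<open>p\<close> between
  \<open>r'\<close> and \<open>r\<close>, and replaced by \<open>p\<close> below.\<close>

definition cone_off ::
    "(real \<times> 'b \<Rightarrow> 'b) \<Rightarrow> 'b \<Rightarrow> ('z \<Rightarrow> real) \<Rightarrow> real \<Rightarrow> real \<Rightarrow> ('z \<Rightarrow> 'b) \<Rightarrow> 'z \<Rightarrow> 'b" where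
  "cone_off H p l r r' G z = (if r \<le> l z then H (cutoff r r' (l z), G z) else p)"

definition contraction_to :: "'b topology \<Rightarrow> (real \<times> 'b \<Rightarrow> 'b) \<Rightarrow> 'b \<Rightarrow> bool" where
  "contraction_to W H p \<longleftrightarrow> p \<in> topspace W \<and> continuous_map (prod_topology unit_interval W) W H \<and>
     (\<forall>w \<in> topspace W. H (0,w) = w \<and> H (1,w) = p)"

text \<open>At height \<open>r\<close> the cutoff is 1 and the contraction has reached
  \<open>p\<close>, so the two branches agree there whatever \<open>G\<close> is.\<close>

lemma continuous_map_cone_off:
  assumes H: "contraction_to W H p" and l: "continuous_map Z euclideanreal l" and "r < r'"
    and G: "continuous_map (subtopology Z {z \<in> topspace Z. r \<le> l z}) W G"
  shows "continuous_map Z W (cone_off H p l r r' G)"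
proof -
  have Hc: "continuous_map (prod_topology unit_interval W) W H"
    using H by (simp add: contraction_to_def)
  show ?thesis
    unfolding cone_off_def[abs_def]
  proof (rule continuous_map_cases_le)
    show "continuous_map (subtopology Z {z \<in> topspace Z. r \<le> l z}) W (\<lambda>z. H (cutoff r r' (l z), G z))"
    proof (rule continuous_map_compose[OF _ Hc, unfolded o_def])
      show "continuous_map (subtopology Z {z \<in> topspace Z. r \<le> l z}) (prod_topology unit_interval W)
         (\<lambda>z. (cutoff r r' (l z), G z))"
        using \<open>r < r'\<close> G by (auto intro!: continuous_intros continuous_map_from_subtopology[OF l]
            simp: continuous_map_in_subtopology cutoff_bounds)
    qed
    show "H (cutoff r r' (l z), G z) = p" if "z \<in> topspace Z" "r = l z" for z
    proof -
      have "G z \<in> topspace W"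
        using continuous_map_image_subset_topspace[OF G] that by auto
      then show ?thesis
        using H that \<open>r < r'\<close> by (simp add: cutoff_low contraction_to_def)
    qed
  qed (use H l in \<open>auto simp: contraction_to_def\<close>)
qed

lemma cone_off_high:
  assumes "contraction_to W H p" "r < r'" "r' \<le> l z" "G z \<in> topspace W"
  shows "cone_off H p l r r' G z = G z"
  using assms by (simp add: cone_off_def cutoff_high contraction_to_def)

lemma open_cylinder_contraction:
  assumes X: "contractible_space X" "topspace X \<noteq> {}" and A: "A \<subseteq> topspace X"
  obtains H p where "contraction_to (open_cylinder X A) H p"
proof -
  let ?C = "open_cylinder X A"
  have i: "continuous_map X ?C (\<lambda>x. (x, 0))"
    by (rule continuous_map_into_open_cylinder) auto
  have "homotopic_with (\<lambda>x. True) ?C ?C id ((\<lambda>x. (x,0)) \<circ> fst)"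
  proof -
    \<comment> \<open>Scaling the height down to 0 retracts the cylinder onto X. It never leaves the
      cylinder: a positive scaled height comes from a positive height, hence from a point over
      A.\<close>
    let ?h = "\<lambda>w::real \<times> 'a \<times> real. (fst (snd w), (1 - fst w) * snd (snd w))"
    have "continuous_map (prod_topology unit_interval ?C) ?C ?h"
    proof (rule continuous_map_into_open_cylinder)
      show "continuous_map (prod_topology unit_interval ?C) X (\<lambda>w. fst (snd w))"
        by (rule continuous_map_compose[OF continuous_map_snd continuous_map_open_cylinder_fst, unfolded o_def])
      have "continuous_map (prod_topology unit_interval ?C) euclideanreal (\<lambda>w. snd (snd w))"
        by (rule continuous_map_compose[OF continuous_map_snd continuous_map_open_cylinder_snd, unfolded o_def])
      moreover have "continuous_map (prod_topology unit_interval ?C) euclideanreal fst"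
        using continuous_map_fst continuous_map_into_fulltopology by blast
      ultimately show "continuous_map (prod_topology unit_interval ?C) euclideanreal (\<lambda>w. (1 - fst w) * snd (snd w))"
        by (intro continuous_intros) auto
      fix w assume "w \<in> topspace (prod_topology unit_interval ?C)"
      then obtain u x s where w: "w = (u,x,s)" "0 \<le> u" "u \<le> 1" "0 \<le> s" "s < 1" "x \<in> A \<or> s = 0"
        by (auto simp: topspace_open_cylinder)
      have "(1 - u) * s \<le> 1 * s"
        using w by (intro mult_right_mono) auto
      then show "0 \<le> (1 - fst w) * snd (snd w) \<and> (1 - fst w) * snd (snd w) < 1 \<and>
          (fst (snd w) \<in> A \<or> (1 - fst w) * snd (snd w) = 0)"
        using w by auto
    qed
    then show ?thesis
      unfolding homotopic_with_def by (intro exI[of _ ?h]) auto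
  qed
  then have "homotopic_with (\<lambda>x. True) ?C ?C ((\<lambda>x. (x,0)) \<circ> fst) id"
    by (simp add: homotopic_with_sym)
  moreover have "homotopic_with (\<lambda>x. True) X X (fst \<circ> (\<lambda>x. (x,0::real))) id"
    by (simp add: o_def id_def)
  ultimately have "?C homotopy_equivalent_space X"
    using i continuous_map_open_cylinder_fst unfolding homotopy_equivalent_space_def by blast
  then have "contractible_space ?C"
    using X homotopy_equivalent_space_contractibility by blast
  then obtain p where "homotopic_with (\<lambda>x. True) ?C ?C id (\<lambda>x. p)"
    by (auto simp: contractible_space_def)
  then obtain H where H: "continuous_map (prod_topology unit_interval ?C) ?C H"
      "\<And>w. H (0,w) = w" "\<And>w. H (1,w) = p"
    by (auto simp: homotopic_with_def)
  \<comment> \<open>Contractibility alone does not place \<open>p\<close> in the space; a point of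
    the space does, by following it to the end of the contraction.\<close>
  obtain x where "x \<in> topspace X" using X by blast
  then have "(1, (x,0)) \<in> topspace (prod_topology unit_interval ?C)"
    by (simp add: topspace_open_cylinder)
  then have "H (1, (x,0)) \<in> topspace ?C"
    using continuous_map_image_subset_topspace[OF H(1)] by blast
  then have "contraction_to ?C H p"
    using H by (simp add: contraction_to_def)
  then show ?thesis
    using that by blast
qed

text \<open>A self-map that is a product near the end is determined, up to proper homotopy, by its germ
  there: coning off the inner part via the contraction forgets everything else.\<close>

lemma properly_homotopic_open_cylinder_id:
  assumes X: "compact_space X" "Hausdorff_space X" "closedin X A"
    and H: "contraction_to (open_cylinder X A) H p"
    and F: "continuous_map (open_cylinder X A) (open_cylinder X A) F"
    and F_eq: "\<And>x s. x \<in> A \<Longrightarrow> 1/2 \<le> s \<Longrightarrow> s < 1 \<Longrightarrow> F (x,s) = (\<kappa> x, s)"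
    and K: "homotopic_with (\<lambda>x. True) (subtopology X A) (subtopology X A) \<kappa> id"
  shows "properly_homotopic (open_cylinder X A) (open_cylinder X A) F id"
proof -
  let ?C = "open_cylinder X A" and ?A = "subtopology X A"
  let ?P = "prod_topology unit_interval ?C"
  let ?cut = "\<lambda>z::'a \<times> real. cutoff (1/2) (3/4) (snd z)"
  have A: "A \<subseteq> topspace X"
    using X closedin_subset by blast
  have Hc: "continuous_map ?P ?C H"
    using H by (simp add: contraction_to_def)
  have H0: "\<And>w. w \<in> topspace ?C \<Longrightarrow> H (0,w) = w" and H1: "\<And>w. w \<in> topspace ?C \<Longrightarrow> H (1,w) = p"
    using H by (auto simp: contraction_to_def)
  obtain k where k: "continuous_map (prod_topology unit_interval ?A) ?A k"
    "\<And>x. k (0,x) = \<kappa> x" "\<And>x. k (1,x) = x"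
    using K by (auto simp: homotopic_with_def)
  have kA: "k (u,x) \<in> A" if "0 \<le> u" "u \<le> 1" "x \<in> A" for u x
  proof -
    have "(u,x) \<in> topspace (prod_topology unit_interval ?A)"
      using that A by auto
    then show ?thesis
      using continuous_map_image_subset_topspace[OF k(1)] by auto
  qed
  have Ft: "F z \<in> topspace ?C" if "z \<in> topspace ?C" for z
    using F that by (auto simp: continuous_map_def)
  have high: "fst z \<in> A" "0 \<le> snd z" "snd z < 1" if "z \<in> topspace ?C" "1/2 \<le> snd z" for z
    using that by (auto simp: topspace_open_cylinder)
  have fstP: "continuous_map ?P euclideanreal fst"
    using continuous_map_fst continuous_map_into_fulltopology by blast
  have sndP: "continuous_map ?P euclideanreal (\<lambda>w. snd (snd w))"
    by (rule continuous_map_compose[OF continuous_map_snd continuous_map_open_cylinder_snd, unfolded o_def])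
  have cutc: "continuous_map ?P euclideanreal (\<lambda>w. ?cut (snd w))"
    by (intro continuous_intros sndP) auto
  \<comment> \<open>Three homotopies in succession, each keeping heights from \<open>3/4\<close> on.
    \<open>h1\<close> switches the contraction on, after which only the values of \<open>F\<close>
    from height \<open>1/2\<close> on matter, and there \<open>F\<close> is a product.
    \<open>h2\<close> deforms that product from \<open>\<kappa>\<close> to the identity under the
    coning. \<open>h3\<close> switches the contraction off again, now with the identity in place of
    \<open>F\<close>.\<close>
  define h1 where "h1 w = H (fst w * ?cut (snd w), F (snd w))" for w
  define G where "G w = (k (fst w, fst (snd w)), snd (snd w))" for w :: "real \<times> 'a \<times> real"
  define h2 where "h2 = cone_off H p (\<lambda>w. snd (snd w)) (1/2) (3/4) G"
  define h3 where "h3 w = H ((1 - fst w) * ?cut (snd w), snd w)" for w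
  have mult_le: "u * cutoff (1/2) (3/4) v \<le> 1" if "0 \<le> u" "u \<le> 1" for u v
    using that cutoff_bounds[of "1/2" "3/4" v] by (simp add: mult_le_one)
  have "continuous_map ?P ?C h1"
    unfolding h1_def
  proof (rule continuous_map_compose[OF _ Hc, unfolded o_def])
    have "continuous_map ?P ?C (\<lambda>w. F (snd w))"
      by (rule continuous_map_compose[OF continuous_map_snd F, unfolded o_def])
    then show "continuous_map ?P ?P (\<lambda>w. (fst w * ?cut (snd w), F (snd w)))"
      by (auto intro!: continuous_intros fstP cutc simp: continuous_map_in_subtopology cutoff_bounds mult_le)
  qed
  moreover have "snd (h1 (u,z)) = snd z" if "0 \<le> u" "u \<le> 1" "z \<in> topspace ?C" "3/4 \<le> snd z" for u z
    using that high[of z] F_eq[of "fst z" "snd z"] Ft[of z] by (simp add: h1_def cutoff_high H0)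
  ultimately have h1: "proper_continuous_map ?P ?C h1"
    by (intro proper_continuous_map_cylinder_homotopy[where r = "3/4"] X) auto
  have "continuous_map ?P ?C h2"
    unfolding h2_def
  proof (rule continuous_map_cone_off[OF H sndP])
    let ?S = "{w \<in> topspace ?P. 1/2 \<le> snd (snd w)}"
    have "continuous_map (subtopology ?P ?S) (prod_topology unit_interval ?A) (\<lambda>w. (fst w, fst (snd w)))"
    proof (rule continuous_map_pairedI)
      show "continuous_map (subtopology ?P ?S) unit_interval fst"
        by (simp add: continuous_map_fst continuous_map_from_subtopology)
      have "continuous_map ?P X (\<lambda>w. fst (snd w))"
        by (rule continuous_map_compose[OF continuous_map_snd continuous_map_open_cylinder_fst, unfolded o_def])
      then show "continuous_map (subtopology ?P ?S) ?A (\<lambda>w. fst (snd w))"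
        using high by (auto simp: continuous_map_in_subtopology continuous_map_from_subtopology)
    qed
    from continuous_map_compose[OF this k(1), unfolded o_def]
    have "continuous_map (subtopology ?P ?S) X (\<lambda>w. k (fst w, fst (snd w)))"
      by (rule continuous_map_into_fulltopology)
    then show "continuous_map (subtopology ?P ?S) ?C G"
      unfolding G_def
      by (rule continuous_map_into_open_cylinder)
        (use high kA in \<open>auto intro: continuous_map_from_subtopology[OF sndP]\<close>)
  qed auto
  moreover have "snd (h2 (u,z)) = snd z" if "0 \<le> u" "u \<le> 1" "z \<in> topspace ?C" "3/4 \<le> snd z" for u z
  proof -
    have "G (u,z) \<in> topspace ?C"
      using that high[of z] kA[of u "fst z"] A by (auto simp: topspace_open_cylinder G_def)
    then have "h2 (u,z) = G (u,z)"
      unfolding h2_def using that by (intro cone_off_high[OF H]) auto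
    then show ?thesis
      by (simp add: G_def)
  qed
  ultimately have h2: "proper_continuous_map ?P ?C h2"
    by (intro proper_continuous_map_cylinder_homotopy[where r = "3/4"] X) auto
  have "continuous_map ?P ?C h3"
    unfolding h3_def
  proof (rule continuous_map_compose[OF _ Hc, unfolded o_def])
    show "continuous_map ?P ?P (\<lambda>w. ((1 - fst w) * ?cut (snd w), snd w))"
      by (auto intro!: continuous_intros fstP cutc simp: continuous_map_in_subtopology cutoff_bounds mult_le)
  qed
  moreover have "snd (h3 (u,z)) = snd z" if "0 \<le> u" "u \<le> 1" "z \<in> topspace ?C" "3/4 \<le> snd z" for u z
    using that by (simp add: h3_def cutoff_high H0)
  ultimately have h3: "proper_continuous_map ?P ?C h3"
    by (intro proper_continuous_map_cylinder_homotopy[where r = "3/4"] X) auto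
  have e1: "h1 (0,z) = F z" "h1 (1,z) = h2 (0,z)" if z: "z \<in> topspace ?C" for z
  proof -
    show "h1 (0,z) = F z"
      using z by (simp add: h1_def H0 Ft)
    show "h1 (1,z) = h2 (0,z)"
    proof (cases "1/2 \<le> snd z")
      case True
      then show ?thesis
        using high[OF z True] F_eq[of "fst z" "snd z"]
        by (simp add: h1_def h2_def cone_off_def G_def k)
    next
      case False
      then show ?thesis
        using Ft[OF z] by (simp add: h1_def h2_def cone_off_def cutoff_low H1)
    qed
  qed
  have e2: "h2 (1,z) = h3 (0,z)" "h3 (1,z) = id z" if z: "z \<in> topspace ?C" for z
    using z by (auto simp: h2_def h3_def cone_off_def G_def k cutoff_low H0 H1)
  have "properly_homotopic ?C ?C F (\<lambda>z. h1 (1,z))"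
    using h1 e1 by (auto simp: properly_homotopic_def)
  moreover have "properly_homotopic ?C ?C (\<lambda>z. h1 (1,z)) (\<lambda>z. h2 (1,z))"
    using h2 e1 by (auto simp: properly_homotopic_def)
  moreover have "properly_homotopic ?C ?C (\<lambda>z. h2 (1,z)) id"
    using h3 e2 by (auto simp: properly_homotopic_def)
  ultimately show ?thesis
    using properly_homotopic_trans by blast
qed

text \<open>The product of \<open>f\<close> with the identity of heights makes sense at positive
  heights. Coning it off between heights \<open>1/4\<close> and \<open>1/2\<close> leaves it intact
  from \<open>1/2\<close> on, the threshold used in
  \<open>properly_homotopic_open_cylinder_id\<close>.\<close>

lemma extend_to_open_cylinder:
  assumes X: "compact_space X" "closedin X A" and Y: "Hausdorff_space Y" "B \<subseteq> topspace Y"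
    and H: "contraction_to (open_cylinder Y B) H p"
    and f: "continuous_map (subtopology X A) (subtopology Y B) f"
  obtains F where "proper_continuous_map (open_cylinder X A) (open_cylinder Y B) F"
    "\<And>x s. x \<in> A \<Longrightarrow> 1/2 \<le> s \<Longrightarrow> s < 1 \<Longrightarrow> F (x,s) = (f x, s)"
proof -
  let ?C = "open_cylinder X A" and ?D = "open_cylinder Y B"
  have A: "A \<subseteq> topspace X"
    using X closedin_subset by blast
  have fB: "f x \<in> B" if "x \<in> A" for x
    using f that A by (auto simp: continuous_map_def)
  let ?G = "\<lambda>z. (f (fst z), snd z)"
  define F where "F = cone_off H p snd (1/4) (1/2) ?G"
  have eq: "F (x,s) = (f x, s)" if "x \<in> A" "1/2 \<le> s" "s < 1" for x s
  proof -
    have "F (x,s) = ?G (x,s)"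
      unfolding F_def using that fB Y
      by (intro cone_off_high[OF H]) (auto simp: topspace_open_cylinder)
    then show ?thesis by simp
  qed
  have "continuous_map ?C ?D F"
    unfolding F_def
  proof (rule continuous_map_cone_off[OF H continuous_map_open_cylinder_snd])
    let ?S = "{z \<in> topspace ?C. 1/4 \<le> snd z}"
    have "continuous_map (subtopology ?C ?S) (subtopology X A) fst"
      by (auto simp: continuous_map_in_subtopology topspace_open_cylinder
          intro: continuous_map_from_subtopology[OF continuous_map_open_cylinder_fst])
    from continuous_map_compose[OF this f, unfolded o_def]
    have "continuous_map (subtopology ?C ?S) Y (\<lambda>z. f (fst z))"
      by (rule continuous_map_into_fulltopology)
    then show "continuous_map (subtopology ?C ?S) ?D ?G"
      by (rule continuous_map_into_open_cylinder)
        (use fB in \<open>auto simp: topspace_open_cylinder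
           intro: continuous_map_from_subtopology[OF continuous_map_open_cylinder_snd]\<close>)
  qed auto
  then have "proper_continuous_map ?C ?D F"
    using eq by (intro proper_continuous_map_open_cylinder[where r = "1/2"] X Y)
      (auto simp: topspace_open_cylinder)
  then show ?thesis
    using eq that by blast
qed

lemma open_cylinders_properly_homotopy_equivalent:
  assumes X: "compact_space X" "Hausdorff_space X" "contractible_space X" "topspace X \<noteq> {}"
      "closedin X A"
    and Y: "compact_space Y" "Hausdorff_space Y" "contractible_space Y" "topspace Y \<noteq> {}"
      "closedin Y B"
    and AB: "subtopology X A homotopy_equivalent_space subtopology Y B"
  shows "properly_homotopy_equivalent_space (open_cylinder X A) (open_cylinder Y B)"
proof -
  have A: "A \<subseteq> topspace X" and B: "B \<subseteq> topspace Y"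
    using X Y closedin_subset by blast+
  obtain f g where f: "continuous_map (subtopology X A) (subtopology Y B) f"
    and g: "continuous_map (subtopology Y B) (subtopology X A) g"
    and gf: "homotopic_with (\<lambda>x. True) (subtopology X A) (subtopology X A) (g \<circ> f) id"
    and fg: "homotopic_with (\<lambda>x. True) (subtopology Y B) (subtopology Y B) (f \<circ> g) id"
    using AB unfolding homotopy_equivalent_space_def by blast
  have fB: "f x \<in> B" if "x \<in> A" for x
    using f that A by (auto simp: continuous_map_def)
  have gA: "g y \<in> A" if "y \<in> B" for y
    using g that B by (auto simp: continuous_map_def)
  obtain H p where H: "contraction_to (open_cylinder X A) H p"
    using open_cylinder_contraction X A by metis
  obtain J q where J: "contraction_to (open_cylinder Y B) J q"
    using open_cylinder_contraction Y B by metis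
  obtain F where F: "proper_continuous_map (open_cylinder X A) (open_cylinder Y B) F"
    and Feq: "\<And>x s. x \<in> A \<Longrightarrow> 1/2 \<le> s \<Longrightarrow> s < 1 \<Longrightarrow> F (x,s) = (f x, s)"
    using extend_to_open_cylinder[OF X(1,5) Y(2) B J f] by metis
  obtain G where G: "proper_continuous_map (open_cylinder Y B) (open_cylinder X A) G"
    and Geq: "\<And>y s. y \<in> B \<Longrightarrow> 1/2 \<le> s \<Longrightarrow> s < 1 \<Longrightarrow> G (y,s) = (g y, s)"
    using extend_to_open_cylinder[OF Y(1,5) X(2) A H g] by metis
  have "continuous_map (open_cylinder X A) (open_cylinder X A) (G \<circ> F)"
    "continuous_map (open_cylinder Y B) (open_cylinder Y B) (F \<circ> G)"
    using F G by (auto simp: proper_continuous_map_def intro: continuous_map_compose)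
  \<comment> \<open>Both extensions keep heights from \<open>1/2\<close> on, so there the composites
    are the products of \<open>g \<circ> f\<close> and \<open>f \<circ> g\<close> with the identity
    of heights.\<close>
  then have "properly_homotopic (open_cylinder X A) (open_cylinder X A) (G \<circ> F) id"
    "properly_homotopic (open_cylinder Y B) (open_cylinder Y B) (F \<circ> G) id"
    using properly_homotopic_open_cylinder_id[OF X(1,2,5) H _ _ gf]
      properly_homotopic_open_cylinder_id[OF Y(1,2,5) J _ _ fg] Feq Geq fB gA
    by auto
  then show ?thesis
    using F G unfolding properly_homotopy_equivalent_space_def by blast
qed

text \<open>Two homotopies are joined. The first slides the height of \<open>f (x,s)\<close> to the
  constant \<open>t\<close> before \<open>g\<close> is applied; it stays at least \<open>b\<close>,
  where \<open>g\<close> avoids height 0. The second is \<open>h\<close> along the slice at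
  \<open>s\<close>, from \<open>g (f (x,s))\<close> to \<open>(x,s)\<close>. Both stay at positive
  height, so projecting to the first component lands in A throughout.\<close>

lemma open_cylinder_slices_homotopic:
  assumes f: "continuous_map (open_cylinder X A) (open_cylinder Y B) f"
    and g: "continuous_map (open_cylinder Y B) (open_cylinder X A) g"
    and h: "continuous_map (prod_topology unit_interval (open_cylinder X A)) (open_cylinder X A) h"
    and h0: "\<And>z. z \<in> topspace (open_cylinder X A) \<Longrightarrow> h (0,z) = g (f z)"
    and h1: "\<And>z. z \<in> topspace (open_cylinder X A) \<Longrightarrow> h (1,z) = z"
    and A: "A \<subseteq> topspace X" and B: "B \<subseteq> topspace Y"
    and b: "0 < b"
    and gb: "\<And>w. w \<in> topspace (open_cylinder Y B) \<Longrightarrow> b \<le> snd w \<Longrightarrow> 0 < snd (g w)"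
    and s: "0 < s" "s < 1" and t: "b \<le> t" "t < 1"
    and fs: "\<And>x. x \<in> A \<Longrightarrow> b \<le> snd (f (x,s))"
    and hs: "\<And>u x. 0 \<le> u \<Longrightarrow> u \<le> 1 \<Longrightarrow> x \<in> A \<Longrightarrow> 0 < snd (h (u,(x,s)))"
  shows "homotopic_with (\<lambda>x. True) (subtopology X A) (subtopology X A)
           ((\<lambda>y. fst (g (y,t))) \<circ> (\<lambda>x. fst (f (x,s)))) id"
proof -
  let ?C = "open_cylinder X A" and ?D = "open_cylinder Y B" and ?A = "subtopology X A"
  let ?P = "prod_topology unit_interval ?A"
  have fstP: "continuous_map ?P euclideanreal fst"
    using continuous_map_fst continuous_map_into_fulltopology by blast
  have sndP: "continuous_map ?P X snd"
    using continuous_map_snd continuous_map_into_fulltopology by blast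
  have posA: "fst z \<in> A" if "z \<in> topspace ?C" "0 < snd z" for z
    using that by (auto simp: topspace_open_cylinder)
  have slice: "(x,s) \<in> topspace ?C" if "x \<in> A" for x
    using that s A by (auto simp: topspace_open_cylinder)
  have iP: "continuous_map ?P ?C (\<lambda>w. (snd w, s))"
    by (rule continuous_map_into_open_cylinder) (use s sndP in auto)
  have ft: "f (x,s) \<in> topspace ?D" if "x \<in> A" for x
    using f slice[OF that] by (auto simp: continuous_map_def)
  have fsP: "continuous_map ?P ?D (\<lambda>w. f (snd w, s))"
    using continuous_map_compose[OF iP f] by (simp add: o_def)
  \<comment> \<open>A convex combination of \<open>t\<close> and the height of \<open>f\<close>:
    both lie between \<open>b\<close> and 1, with 1 excluded, so all intermediate heights do
    too.\<close>
  define lev where "lev w = (1 - fst w) * t + fst w * snd (f (snd w, s))" for w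
  have lev: "b \<le> lev w \<and> lev w < 1" if w: "w \<in> topspace ?P" for w
  proof -
    have *: "0 \<le> fst w" "fst w \<le> 1" "snd w \<in> A"
      using w by auto
    have "(1 - fst w) * b + fst w * b \<le> lev w"
      unfolding lev_def using * fs t by (intro add_mono mult_left_mono) auto
    moreover have "lev w < 1"
      unfolding lev_def
      using convex_bound_lt[of t 1 "snd (f (snd w, s))" "1 - fst w" "fst w"] * t ft[OF *(3)]
      by (auto simp: topspace_open_cylinder)
    ultimately show ?thesis
      by (simp add: algebra_simps)
  qed
  define m where "m w = (fst (f (snd w, s)), lev w)" for w
  have "continuous_map ?P euclideanreal (\<lambda>w. snd (f (snd w, s)))"
    "continuous_map ?P Y (\<lambda>w. fst (f (snd w, s)))"
    using continuous_map_compose[OF fsP continuous_map_open_cylinder_snd]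
      continuous_map_compose[OF fsP continuous_map_open_cylinder_fst]
    by (auto simp: o_def)
  moreover have "fst (f (x,s)) \<in> B" if "x \<in> A" for x
    using ft[OF that] fs[OF that] b by (auto simp: topspace_open_cylinder)
  ultimately have mP: "continuous_map ?P ?D m"
    unfolding m_def using lev b t
    by (intro continuous_map_into_open_cylinder)
      (force simp: lev_def intro!: continuous_intros fstP)+
  have gmP: "continuous_map ?P ?C (\<lambda>w. g (m w))"
    using continuous_map_compose[OF mP g] by (simp add: o_def)
  have gm: "g (m w) \<in> topspace ?C" "0 < snd (g (m w))" if w: "w \<in> topspace ?P" for w
    using gb[of "m w"] lev[OF w] funcset_mem[OF continuous_map_funspace[OF gmP] w]
      funcset_mem[OF continuous_map_funspace[OF mP] w] by (simp_all add: m_def)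
  have "continuous_map ?P ?A (\<lambda>w. fst (g (m w)))"
    using continuous_map_compose[OF gmP continuous_map_open_cylinder_fst] gm posA
    by (auto simp: o_def continuous_map_in_subtopology)
  then have 1: "homotopic_with (\<lambda>x. True) ?A ?A (\<lambda>x. fst (g (m (0,x)))) (\<lambda>x. fst (g (m (1,x))))"
    unfolding homotopic_with_def by (intro exI[of _ "\<lambda>w. fst (g (m w))"]) auto
  have jP: "continuous_map ?P (prod_topology unit_interval ?C) (\<lambda>w. (fst w, (snd w, s)))"
    by (intro continuous_map_pairedI continuous_map_fst iP)
  have hP: "continuous_map ?P ?C (\<lambda>w. h (fst w, (snd w, s)))"
    using continuous_map_compose[OF jP h] by (simp add: o_def)
  have "fst (h (fst w, (snd w, s))) \<in> A" if w: "w \<in> topspace ?P" for w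
    using posA[OF funcset_mem[OF continuous_map_funspace[OF hP] w]] hs[of "fst w" "snd w"] w
    by (simp add: mem_Times_iff)
  then have "continuous_map ?P ?A (\<lambda>w. fst (h (fst w, (snd w, s))))"
    using continuous_map_compose[OF hP continuous_map_open_cylinder_fst]
    by (simp add: o_def continuous_map_in_subtopology Pi_iff)
  then have 2: "homotopic_with (\<lambda>x. True) ?A ?A (\<lambda>x. fst (h (0,(x,s)))) (\<lambda>x. fst (h (1,(x,s))))"
    unfolding homotopic_with_def by (intro exI[of _ "\<lambda>w. fst (h (fst w, (snd w, s)))"]) auto
  have "homotopic_with (\<lambda>x. True) ?A ?A (\<lambda>x. fst (g (m (0,x)))) (\<lambda>x. fst (h (1,(x,s))))"
  proof (rule homotopic_with_trans[OF 1])
    show "homotopic_with (\<lambda>x. True) ?A ?A (\<lambda>x. fst (g (m (1,x)))) (\<lambda>x. fst (h (1,(x,s))))"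
      by (rule homotopic_with_eq[OF 2]) (auto simp: m_def lev_def h0[OF slice])
  qed
  then show ?thesis
    by (rule homotopic_with_eq) (auto simp: m_def lev_def h1[OF slice])
qed

lemma proper_map_level:
  assumes "compact_space Y" "closedin Y B" "b < 1"
    and F: "proper_continuous_map (open_cylinder X A) (open_cylinder Y B) F"
  obtains c where "0 < c" "c < 1"
    "\<And>z. z \<in> topspace (open_cylinder X A) \<Longrightarrow> c \<le> snd z \<Longrightarrow> b < snd (F z)"
proof -
  let ?K = "{z \<in> topspace (open_cylinder Y B). snd z \<le> b}"
  have "compactin (open_cylinder X A) {z \<in> topspace (open_cylinder X A). F z \<in> ?K}"
    using F compactin_open_cylinder_le[OF assms(1-3)] unfolding proper_continuous_map_def by blast
  then obtain c where c: "0 \<le> c" "c < 1"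
    "\<And>z. z \<in> topspace (open_cylinder X A) \<Longrightarrow> F z \<in> ?K \<Longrightarrow> snd z \<le> c"
    using compactin_open_cylinder_bounded by (metis (mono_tags, lifting) mem_Collect_eq)
  have "F z \<in> topspace (open_cylinder Y B)" if "z \<in> topspace (open_cylinder X A)" for z
    using F that by (auto simp: proper_continuous_map_def continuous_map_def)
  \<comment> \<open>The bound \<open>c\<close> may be attained in the preimage and may be 0; the
    midpoint of \<open>c\<close> and 1 is strictly above it and positive.\<close>
  then show ?thesis
    using c by (intro that[of "(c + 1) / 2"]) force+
qed

text \<open>One \<open>c\<close> serves all times \<open>u\<close>, because the homotopy is proper
  on the product; proper stages alone would give a bound depending on \<open>u\<close>. The compact
  preimage is projected to the cylinder to get it.\<close>

lemma proper_homotopy_level: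
  assumes "compact_space Y" "closedin Y B" "b < 1"
    and F: "proper_continuous_map (prod_topology unit_interval (open_cylinder X A)) (open_cylinder Y B) F"
  obtains c where "0 < c" "c < 1"
    "\<And>u z. 0 \<le> u \<Longrightarrow> u \<le> 1 \<Longrightarrow> z \<in> topspace (open_cylinder X A) \<Longrightarrow> c \<le> snd z \<Longrightarrow> b < snd (F (u,z))"
proof -
  let ?K = "{z \<in> topspace (open_cylinder Y B). snd z \<le> b}"
  let ?P = "prod_topology unit_interval (open_cylinder X A)"
  have "compactin ?P {z \<in> topspace ?P. F z \<in> ?K}"
    using F compactin_open_cylinder_le[OF assms(1-3)] unfolding proper_continuous_map_def by blast
  then have *: "compactin (open_cylinder X A) (snd ` {z \<in> topspace ?P. F z \<in> ?K})"
    using image_compactin continuous_map_snd by blast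
  obtain c where c: "0 \<le> c" "c < 1"
    "\<And>z. z \<in> snd ` {z \<in> topspace ?P. F z \<in> ?K} \<Longrightarrow> snd z \<le> c"
    using compactin_open_cylinder_bounded[OF *] by blast
  have le: "snd z \<le> c" if "0 \<le> u" "u \<le> 1" "z \<in> topspace (open_cylinder X A)" "F (u,z) \<in> ?K" for u z
  proof -
    have "(u,z) \<in> {z \<in> topspace ?P. F z \<in> ?K}"
      using that by (auto simp only: topspace_prod_topology topspace_euclidean_subtopology
          mem_Collect_eq mem_Times_iff fst_conv snd_conv atLeastAtMost_iff)
    then have "snd (u,z) \<in> snd ` {z \<in> topspace ?P. F z \<in> ?K}"
      by (rule imageI)
    then show ?thesis
      using c(3)[of "snd (u,z)"] by simp
  qed
  have Ft: "F (u,z) \<in> topspace (open_cylinder Y B)"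
    if "0 \<le> u" "u \<le> 1" "z \<in> topspace (open_cylinder X A)" for u z
    using F that by (auto simp: proper_continuous_map_def continuous_map_def)
  have "b < snd (F (u,z))"
    if "0 \<le> u" "u \<le> 1" "z \<in> topspace (open_cylinder X A)" "(c + 1) / 2 \<le> snd z" for u z
  proof -
    have "\<not> snd z \<le> c"
      using that(4) c(2) by simp
    then show ?thesis
      using le[of u z] Ft[of u z] that by force
  qed
  then show ?thesis
    using c(1,2) by (intro that[of "(c + 1) / 2"]) auto
qed

lemma open_cylinder_ends_homotopy_equivalent:
  assumes X: "compact_space X" "closedin X A" and Y: "compact_space Y" "closedin Y B"
    and XY: "properly_homotopy_equivalent_space (open_cylinder X A) (open_cylinder Y B)"
  shows "subtopology X A homotopy_equivalent_space subtopology Y B"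
proof -
  let ?C = "open_cylinder X A" and ?D = "open_cylinder Y B"
  have A: "A \<subseteq> topspace X" and B: "B \<subseteq> topspace Y"
    using X Y closedin_subset by blast+
  obtain f g where f: "proper_continuous_map ?C ?D f" and g: "proper_continuous_map ?D ?C g"
    and gf: "properly_homotopic ?C ?C (g \<circ> f) id" and fg: "properly_homotopic ?D ?D (f \<circ> g) id"
    using XY by (auto simp: properly_homotopy_equivalent_space_def)
  obtain h where h: "proper_continuous_map (prod_topology unit_interval ?C) ?C h"
      "\<And>z. z \<in> topspace ?C \<Longrightarrow> h (0,z) = g (f z)" "\<And>z. z \<in> topspace ?C \<Longrightarrow> h (1,z) = z"
    using gf by (auto simp: properly_homotopic_def)
  obtain k where k: "proper_continuous_map (prod_topology unit_interval ?D) ?D k"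
      "\<And>z. z \<in> topspace ?D \<Longrightarrow> k (0,z) = f (g z)" "\<And>z. z \<in> topspace ?D \<Longrightarrow> k (1,z) = z"
    using fg by (auto simp: properly_homotopic_def)
  have fc: "continuous_map ?C ?D f" and gc: "continuous_map ?D ?C g"
    and hc: "continuous_map (prod_topology unit_interval ?C) ?C h"
    and kc: "continuous_map (prod_topology unit_interval ?D) ?D k"
    using f g h k by (auto simp: proper_continuous_map_def)
  \<comment> \<open>From \<open>bf\<close> and \<open>bg\<close> on, the maps avoid height 0. From
    \<open>cf\<close> on, \<open>f\<close> lands above \<open>bg\<close>, hence where
    \<open>g\<close> avoids height 0, and symmetrically for \<open>cg\<close>. From
    \<open>bh\<close> and \<open>bk\<close> on, the homotopies avoid height 0.\<close>
  obtain bf where bf: "0 < bf" "bf < 1" "\<And>z. z \<in> topspace ?C \<Longrightarrow> bf \<le> snd z \<Longrightarrow> 0 < snd (f z)"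
    using proper_map_level[OF Y zero_less_one f] by metis
  obtain bg where bg: "0 < bg" "bg < 1" "\<And>z. z \<in> topspace ?D \<Longrightarrow> bg \<le> snd z \<Longrightarrow> 0 < snd (g z)"
    using proper_map_level[OF X zero_less_one g] by metis
  obtain cf where cf: "0 < cf" "cf < 1" "\<And>z. z \<in> topspace ?C \<Longrightarrow> cf \<le> snd z \<Longrightarrow> bg < snd (f z)"
    using proper_map_level[OF Y bg(2) f] by metis
  obtain cg where cg: "0 < cg" "cg < 1" "\<And>z. z \<in> topspace ?D \<Longrightarrow> cg \<le> snd z \<Longrightarrow> bf < snd (g z)"
    using proper_map_level[OF X bf(2) g] by metis
  obtain bh where bh: "0 < bh" "bh < 1"
      "\<And>u z. 0 \<le> u \<Longrightarrow> u \<le> 1 \<Longrightarrow> z \<in> topspace ?C \<Longrightarrow> bh \<le> snd z \<Longrightarrow> 0 < snd (h (u,z))"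
    using proper_homotopy_level[OF X zero_less_one h(1)] by metis
  obtain bk where bk: "0 < bk" "bk < 1"
      "\<And>u z. 0 \<le> u \<Longrightarrow> u \<le> 1 \<Longrightarrow> z \<in> topspace ?D \<Longrightarrow> bk \<le> snd z \<Longrightarrow> 0 < snd (k (u,z))"
    using proper_homotopy_level[OF Y zero_less_one k(1)] by metis
  \<comment> \<open>The same pair of heights must serve both composites: \<open>s\<close> is where
    \<open>f\<close> starts in one and where \<open>g\<close> is made to arrive in the
    other.\<close>
  define s where "s = max bf (max cf bh)"
  define t where "t = max bg (max cg bk)"
  have s: "0 < s" "s < 1" "bf \<le> s" "cf \<le> s" "bh \<le> s" and t: "0 < t" "t < 1" "bg \<le> t" "cg \<le> t" "bk \<le> t"
    using bf bg cf cg bh bk by (auto simp: s_def t_def)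
  have xs: "(x,s) \<in> topspace ?C" if "x \<in> A" for x
    using that A s by (auto simp: topspace_open_cylinder)
  have yt: "(y,t) \<in> topspace ?D" if "y \<in> B" for y
    using that B t by (auto simp: topspace_open_cylinder)
  define \<phi> where "\<phi> x = fst (f (x,s))" for x
  define \<psi> where "\<psi> y = fst (g (y,t))" for y
  have slice: "continuous_map (subtopology X' A') (subtopology Y' B') (\<lambda>x. fst (F (x,r)))"
    if F: "continuous_map (open_cylinder X' A') (open_cylinder Y' B') F" and r: "0 < r" "r < 1"
      and A': "A' \<subseteq> topspace X'"
      and pos: "\<And>x. x \<in> A' \<Longrightarrow> 0 < snd (F (x,r))"
    for X' :: "'x topology" and A' and Y' :: "'y topology" and B' F r
  proof -
    have "continuous_map (subtopology X' A') (open_cylinder X' A') (\<lambda>x. (x,r))"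
      by (rule continuous_map_into_open_cylinder) (use r in \<open>auto simp: continuous_map_from_subtopology[OF continuous_map_id[unfolded id_def]]\<close>)
    from continuous_map_compose[OF this F, unfolded o_def]
    have *: "continuous_map (subtopology X' A') (open_cylinder Y' B') (\<lambda>x. F (x,r))" .
    have "F (x,r) \<in> topspace (open_cylinder Y' B')" if "x \<in> A'" for x
      using * that A' by (auto simp: continuous_map_def)
    then have "fst (F (x,r)) \<in> B'" if "x \<in> A'" for x
      using pos[OF that] that by (force simp: topspace_open_cylinder)
    then show ?thesis
      using continuous_map_compose[OF * continuous_map_open_cylinder_fst]
      by (auto simp: continuous_map_in_subtopology o_def)
  qed
  have "continuous_map (subtopology X A) (subtopology Y B) \<phi>"
    unfolding \<phi>_def using bf xs s by (intro slice[OF fc _ _ A]) auto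
  moreover have "continuous_map (subtopology Y B) (subtopology X A) \<psi>"
    unfolding \<psi>_def using bg yt t by (intro slice[OF gc _ _ B]) auto
  moreover have "homotopic_with (\<lambda>x. True) (subtopology X A) (subtopology X A) (\<psi> \<circ> \<phi>) id"
    unfolding \<phi>_def \<psi>_def
    using open_cylinder_slices_homotopic[OF fc gc hc h(2,3) A B bg(1,3) s(1,2) t(3,2)] cf(3) bh(3) s xs
    by (simp add: less_imp_le)
  moreover have "homotopic_with (\<lambda>x. True) (subtopology Y B) (subtopology Y B) (\<phi> \<circ> \<psi>) id"
    unfolding \<phi>_def \<psi>_def
    using open_cylinder_slices_homotopic[OF gc fc kc k(2,3) B A bf(1,3) t(1,2) s(3,2)] cg(3) bk(3) t yt
    by (simp add: less_imp_le)
  ultimately show ?thesis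
    unfolding homotopy_equivalent_space_def by blast
qed

section \<open>Collars\<close>

text \<open>The height varies with the point so that the collar can grow over one part of A at a
  time. Height 0 gives back X, and height 1 with its top removed gives the open cylinder.\<close>

definition attach_collar :: "'a topology \<Rightarrow> 'a set \<Rightarrow> ('a \<Rightarrow> real) \<Rightarrow> ('a \<times> real) topology" where
  "attach_collar X A \<psi> =
     subtopology (prod_topology X euclideanreal) {(x,s). s = 0 \<or> x \<in> A \<and> 0 \<le> s \<and> s \<le> \<psi> x}"

lemma topspace_attach_collar:
  "topspace (attach_collar X A \<psi>) =
     {(x,s). x \<in> topspace X \<and> (s = 0 \<or> x \<in> A \<and> 0 \<le> s \<and> s \<le> \<psi> x)}"
  by (auto simp: attach_collar_def)

lemma continuous_map_attach_collar_fst: "continuous_map (attach_collar X A \<psi>) X fst"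
  unfolding attach_collar_def by (rule continuous_map_from_subtopology[OF continuous_map_fst])

lemma continuous_map_attach_collar_snd: "continuous_map (attach_collar X A \<psi>) euclideanreal snd"
  unfolding attach_collar_def by (rule continuous_map_from_subtopology[OF continuous_map_snd])

text \<open>\<open>c\<close> identifies \<open>(A \<inter> K) \<times> [0,1]\<close> with \<open>K\<close>, and \<open>(\<pi>, t)\<close> is its inverse.\<close>

definition local_collar ::
    "'a topology \<Rightarrow> 'a set \<Rightarrow> 'a set \<Rightarrow> 'a set \<Rightarrow> ('a \<Rightarrow> 'a) \<Rightarrow> ('a \<Rightarrow> real) \<Rightarrow> ('a \<times> real \<Rightarrow> 'a) \<Rightarrow> bool"
  where
  "local_collar X A W K \<pi> t c \<longleftrightarrow>
     openin X W \<and> closedin X K \<and> W \<subseteq> K \<and>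
     continuous_map (subtopology X K) X \<pi> \<and>
     continuous_map (subtopology X K) euclideanreal t \<and>
     continuous_map (prod_topology (subtopology X (A \<inter> K)) unit_interval) X c \<and>
     (\<forall>y \<in> K. \<pi> y \<in> A \<inter> K \<and> 0 \<le> t y \<and> t y \<le> 1 \<and> c (\<pi> y, t y) = y) \<and>
     (\<forall>x \<in> A \<inter> K. \<forall>u \<in> {0..1}. c (x,u) \<in> K \<and> \<pi> (c (x,u)) = x \<and> t (c (x,u)) = u) \<and>
     (\<forall>x \<in> A \<inter> K. \<pi> x = x \<and> t x = 0) \<and>
     (\<forall>y \<in> K - W. t y = 1 \<or> \<pi> y \<notin> W)"

text \<open>In the coordinate \<open>t - s\<close>, the part of the attached collar over \<open>x\<close> together with the local
  collar at \<open>x\<close> is the interval \<open>[-\<psi> x, 1]\<close>, which is mapped affinely onto \<open>[-\<psi>' x, 1]\<close>.\<close>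

definition stretch_coord :: "('a \<Rightarrow> 'a) \<Rightarrow> ('a \<Rightarrow> real) \<Rightarrow> ('a \<Rightarrow> real) \<Rightarrow> ('a \<Rightarrow> real) \<Rightarrow> 'a \<times> real \<Rightarrow> real"
  where
  "stretch_coord \<pi> t \<psi> \<psi>' z =
     1 - (1 - (t (fst z) - snd z)) * (1 + \<psi>' (\<pi> (fst z))) / (1 + \<psi> (\<pi> (fst z)))"

text \<open>The new coordinate is decoded by its sign: a positive value is a depth in the local
  collar, a negative one is a height in the attached collar. The two readings meet at 0 because
  \<open>c (x,0) = x\<close> on the base.\<close>

definition stretch ::
    "'a set \<Rightarrow> ('a \<Rightarrow> 'a) \<Rightarrow> ('a \<Rightarrow> real) \<Rightarrow> ('a \<times> real \<Rightarrow> 'a) \<Rightarrow> ('a \<Rightarrow> real) \<Rightarrow> ('a \<Rightarrow> real)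
      \<Rightarrow> 'a \<times> real \<Rightarrow> 'a \<times> real"
  where
  "stretch K \<pi> t c \<psi> \<psi>' z =
     (if fst z \<in> K
      then (c (\<pi> (fst z), max (stretch_coord \<pi> t \<psi> \<psi>' z) 0), max (- stretch_coord \<pi> t \<psi> \<psi>' z) 0)
      else z)"

section \<open>Stretching the attached collar along one local collar\<close>

context
  fixes X :: "'a topology" and A W K \<pi> t c
  assumes lc: "local_collar X A W K \<pi> t c"
begin

lemma local_collar_subsets: "W \<subseteq> K" "K \<subseteq> topspace X"
  using lc closedin_subset unfolding local_collar_def by blast+

lemma local_collarD:
  assumes "y \<in> K"
  shows "\<pi> y \<in> A" "\<pi> y \<in> K" "\<pi> y \<in> topspace X" "0 \<le> t y" "t y \<le> 1" "c (\<pi> y, t y) = y"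
    "y \<in> A \<Longrightarrow> \<pi> y = y" "y \<in> A \<Longrightarrow> t y = 0" "y \<notin> W \<Longrightarrow> t y \<noteq> 1 \<Longrightarrow> \<pi> y \<notin> W"
  using lc assms local_collar_subsets unfolding local_collar_def by blast+

lemma local_collarD2:
  assumes "x \<in> A" "x \<in> K" "0 \<le> u" "u \<le> 1"
  shows "c (x,u) \<in> K" "\<pi> (c (x,u)) = x" "t (c (x,u)) = u"
  using lc assms unfolding local_collar_def by auto

lemma local_collar_base:
  assumes "x \<in> A" "x \<in> K" shows "c (x,0) = x"
  using local_collarD[OF assms(2)] assms by metis

text \<open>At least one of \<open>t y\<close> and \<open>s\<close> is 0, since \<open>t\<close>
  vanishes on A and \<open>s\<close> vanishes off A. Hence the single number \<open>t y - s\<close>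
  determines both.\<close>

lemma stretch_recover:
  assumes "(y,s) \<in> topspace (attach_collar X A \<psi>)" "y \<in> K"
  shows "(c (\<pi> y, max (t y - s) 0), max (- (t y - s)) 0) = (y,s)"
proof (cases "y \<in> A")
  case True
  then show ?thesis
    using assms local_collarD[of y] local_collar_base[of y]
    by (auto simp: topspace_attach_collar)
next
  case False
  then show ?thesis
    using assms local_collarD[of y] by (auto simp: topspace_attach_collar)
qed

lemma stretch_coord_bounds:
  assumes z: "(y,s) \<in> topspace (attach_collar X A \<psi>)" "y \<in> K"
    and \<psi>: "0 \<le> \<psi> (\<pi> y)" "0 \<le> \<psi>' (\<pi> y)"
  shows "- \<psi>' (\<pi> y) \<le> stretch_coord \<pi> t \<psi> \<psi>' (y,s)" "stretch_coord \<pi> t \<psi> \<psi>' (y,s) \<le> 1"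
proof -
  have "0 \<le> 1 - (t y - s)" "1 - (t y - s) \<le> 1 + \<psi> (\<pi> y)"
    using z \<psi> local_collarD[of y] by (auto simp: topspace_attach_collar)
  \<comment> \<open>The relative position in the fibre, 0 at the inner end 1 and 1 at the outer end
    \<open>- \<psi>\<close>; the affine map preserves it.\<close>
  moreover define q where "q = (1 - (t y - s)) / (1 + \<psi> (\<pi> y))"
  ultimately have "0 \<le> q" "q \<le> 1"
    using \<psi> by (auto simp: divide_le_eq_1)
  then have "0 \<le> q * (1 + \<psi>' (\<pi> y))" "q * (1 + \<psi>' (\<pi> y)) \<le> 1 * (1 + \<psi>' (\<pi> y))"
    using \<psi> by (intro mult_nonneg_nonneg mult_right_mono; simp)+
  moreover have "stretch_coord \<pi> t \<psi> \<psi>' (y,s) = 1 - q * (1 + \<psi>' (\<pi> y))"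
    by (simp add: stretch_coord_def q_def)
  ultimately show "- \<psi>' (\<pi> y) \<le> stretch_coord \<pi> t \<psi> \<psi>' (y,s)" "stretch_coord \<pi> t \<psi> \<psi>' (y,s) \<le> 1"
    by simp_all
qed

lemma stretch_in:
  assumes z: "z \<in> topspace (attach_collar X A \<psi>)"
    and \<psi>: "\<And>x. x \<in> topspace X \<Longrightarrow> 0 \<le> \<psi> x" "\<And>x. x \<in> topspace X \<Longrightarrow> 0 \<le> \<psi>' x"
    and eq: "\<And>x. x \<in> A - W \<Longrightarrow> \<psi>' x = \<psi> x"
  shows "stretch K \<pi> t c \<psi> \<psi>' z \<in> topspace (attach_collar X A \<psi>')"
proof (cases "fst z \<in> K")
  case True
  obtain y s where ys: "z = (y,s)" by (cases z)
  define \<tau> where "\<tau> = stretch_coord \<pi> t \<psi> \<psi>' z"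
  have y: "y \<in> K"
    using True ys by simp
  have \<tau>: "- \<psi>' (\<pi> y) \<le> \<tau>" "\<tau> \<le> 1"
    using stretch_coord_bounds[of y s \<psi> \<psi>'] z y ys \<psi> local_collarD[OF y] by (auto simp: \<tau>_def)
  have "(c (\<pi> y, max \<tau> 0), max (- \<tau>) 0) \<in> topspace (attach_collar X A \<psi>')"
  proof (cases "0 \<le> \<tau>")
    case True
    then show ?thesis
      using local_collarD2[of "\<pi> y" \<tau>] local_collarD[OF y] \<tau> local_collar_subsets
      by (auto simp: topspace_attach_collar)
  next
    case False
    then show ?thesis
      using local_collar_base[of "\<pi> y"] local_collarD[OF y] \<tau>
      by (auto simp: topspace_attach_collar)
  qed
  then show ?thesis
    using y by (simp add: stretch_def ys \<tau>_def)
next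
  case False
  then show ?thesis
    using z local_collar_subsets eq by (force simp: stretch_def topspace_attach_collar)
qed

text \<open>Stretching preserves the base point \<open>\<pi>\<close>, and on each fibre exchanging
  the two height functions inverts the affine map.\<close>

lemma stretch_inverse:
  assumes z: "z \<in> topspace (attach_collar X A \<psi>)"
    and \<psi>: "\<And>x. x \<in> topspace X \<Longrightarrow> 0 \<le> \<psi> x" "\<And>x. x \<in> topspace X \<Longrightarrow> 0 \<le> \<psi>' x"
  shows "stretch K \<pi> t c \<psi>' \<psi> (stretch K \<pi> t c \<psi> \<psi>' z) = z"
proof (cases "fst z \<in> K")
  case True
  obtain y s where ys: "z = (y,s)" by (cases z)
  define \<tau> where "\<tau> = stretch_coord \<pi> t \<psi> \<psi>' z"
  have y: "y \<in> K"
    using True ys by simp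
  note cy = local_collarD[OF y]
  have "0 \<le> \<psi> (\<pi> y)" "0 \<le> \<psi>' (\<pi> y)"
    using \<psi> cy by auto
  then have pos: "1 + \<psi> (\<pi> y) > 0" "1 + \<psi>' (\<pi> y) > 0"
    by auto
  have \<tau>: "- \<psi>' (\<pi> y) \<le> \<tau>" "\<tau> \<le> 1"
    using stretch_coord_bounds[of y s \<psi> \<psi>'] z y ys \<psi> cy by (auto simp: \<tau>_def)
  define y' where "y' = c (\<pi> y, max \<tau> 0)"
  have y': "y' \<in> K" "\<pi> y' = \<pi> y" "t y' = max \<tau> 0"
    unfolding y'_def using local_collarD2[of "\<pi> y" "max \<tau> 0"] cy \<tau> by auto
  have st: "stretch K \<pi> t c \<psi> \<psi>' z = (y', max (- \<tau>) 0)"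
    using y by (simp add: stretch_def ys \<tau>_def y'_def)
  have "t y' - max (- \<tau>) 0 = \<tau>"
    using y' by auto
  then have "stretch_coord \<pi> t \<psi>' \<psi> (y', max (- \<tau>) 0) =
      1 - (1 - \<tau>) * (1 + \<psi> (\<pi> y)) / (1 + \<psi>' (\<pi> y))"
    by (simp add: stretch_coord_def y')
  also have "\<dots> = t y - s"
    using pos by (simp add: \<tau>_def stretch_coord_def ys)
  finally have "stretch K \<pi> t c \<psi>' \<psi> (y', max (- \<tau>) 0) = (c (\<pi> y, max (t y - s) 0), max (- (t y - s)) 0)"
    using y' by (simp add: stretch_def)
  also have "\<dots> = (y,s)"
    using stretch_recover[of y s \<psi>] z y ys by blast
  finally show ?thesis
    using st ys by simp
qed (simp add: stretch_def)

text \<open>The formula over K is pasted with the identity over the complement of W; both sets are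
  closed, and they cover because W is inside K. The last clause of \<open>local_collar\<close> makes
  the two agree over \<open>K - W\<close>.\<close>

lemma continuous_map_stretch:
  assumes \<psi>c: "continuous_map X euclideanreal \<psi>" "continuous_map X euclideanreal \<psi>'"
    and \<psi>: "\<And>x. x \<in> topspace X \<Longrightarrow> 0 \<le> \<psi> x" "\<And>x. x \<in> topspace X \<Longrightarrow> 0 \<le> \<psi>' x"
    and eq: "\<And>x. x \<in> A - W \<Longrightarrow> \<psi>' x = \<psi> x"
  shows "continuous_map (attach_collar X A \<psi>) (attach_collar X A \<psi>') (stretch K \<pi> t c \<psi> \<psi>')"
proof -
  let ?N = "attach_collar X A \<psi>" and ?S = "stretch K \<pi> t c \<psi> \<psi>'" and ?\<tau> = "stretch_coord \<pi> t \<psi> \<psi>'"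
  let ?K = "{z \<in> topspace ?N. fst z \<in> K}" and ?L = "{z \<in> topspace ?N. fst z \<in> topspace X - W}"
  define f where "f b = (if b then (\<lambda>z. (c (\<pi> (fst z), max (?\<tau> z) 0), max (- ?\<tau> z) 0)) else id)" for b
  have "continuous_map ?N (prod_topology X euclideanreal) ?S"
  proof (rule pasting_lemma_closed[where I = UNIV and T = "\<lambda>b. if b then ?K else ?L" and f = f])
    fix b :: bool
    show "closedin ?N (if b then ?K else ?L)"
      using closedin_continuous_map_preimage[OF continuous_map_attach_collar_fst, of X K A \<psi>]
        closedin_continuous_map_preimage[OF continuous_map_attach_collar_fst, of X "topspace X - W" A \<psi>] lc
      by (auto simp: local_collar_def)
    have fstK: "continuous_map (subtopology ?N ?K) (subtopology X K) fst"
      by (auto simp: continuous_map_in_subtopology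
          intro: continuous_map_from_subtopology[OF continuous_map_attach_collar_fst])
    have p: "continuous_map (subtopology ?N ?K) X (\<lambda>z. \<pi> (fst z))"
      and tt: "continuous_map (subtopology ?N ?K) euclideanreal (\<lambda>z. t (fst z))"
      using continuous_map_compose[OF fstK, of X \<pi>] continuous_map_compose[OF fstK, of euclideanreal t] lc
      by (auto simp: local_collar_def o_def)
    have \<tau>c: "continuous_map (subtopology ?N ?K) euclideanreal ?\<tau>"
      unfolding stretch_coord_def
    proof (intro continuous_intros tt)
      show "continuous_map (subtopology ?N ?K) euclideanreal snd"
        by (rule continuous_map_from_subtopology[OF continuous_map_attach_collar_snd])
      show "continuous_map (subtopology ?N ?K) euclideanreal (\<lambda>z. \<psi> (\<pi> (fst z)))"
        "continuous_map (subtopology ?N ?K) euclideanreal (\<lambda>z. \<psi>' (\<pi> (fst z)))"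
        using continuous_map_compose[OF p \<psi>c(1)] continuous_map_compose[OF p \<psi>c(2)]
        by (auto simp: o_def)
      show "1 + \<psi> (\<pi> (fst z)) \<noteq> 0" if "z \<in> topspace (subtopology ?N ?K)" for z
        using \<psi>(1)[of "\<pi> (fst z)"] local_collarD[of "fst z"] that by force
    qed auto
    have "continuous_map (subtopology ?N ?K) (prod_topology (subtopology X (A \<inter> K)) unit_interval)
        (\<lambda>z. (\<pi> (fst z), max (?\<tau> z) 0))"
    proof (intro continuous_map_pairedI)
      show "continuous_map (subtopology ?N ?K) (subtopology X (A \<inter> K)) (\<lambda>z. \<pi> (fst z))"
        using p local_collarD by (auto simp: continuous_map_in_subtopology)
      have "?\<tau> z \<le> 1" if "z \<in> topspace ?N" "fst z \<in> K" for z
        using stretch_coord_bounds(2)[of "fst z" "snd z" \<psi> \<psi>'] that \<psi> local_collarD[OF that(2)] by auto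
      moreover have "continuous_map (subtopology ?N ?K) euclideanreal (\<lambda>z. max (?\<tau> z) 0)"
        by (intro continuous_intros \<tau>c) auto
      ultimately show "continuous_map (subtopology ?N ?K) unit_interval (\<lambda>z. max (?\<tau> z) 0)"
        by (simp add: continuous_map_in_subtopology Pi_iff)
    qed
    moreover have "continuous_map (prod_topology (subtopology X (A \<inter> K)) unit_interval) X c"
      using lc by (simp add: local_collar_def)
    ultimately have "continuous_map (subtopology ?N ?K) X (\<lambda>z. c (\<pi> (fst z), max (?\<tau> z) 0))"
      using continuous_map_compose by (fastforce simp: o_def)
    then have "continuous_map (subtopology ?N ?K) (prod_topology X euclideanreal) (f True)"
      unfolding f_def if_True by (intro continuous_intros \<tau>c) auto
    moreover have "continuous_map (subtopology ?N ?L) (prod_topology X euclideanreal) (f False)"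
      unfolding f_def if_False attach_collar_def
      by (intro continuous_map_from_subtopology continuous_map_id)
    ultimately show "continuous_map (subtopology ?N (if b then ?K else ?L)) (prod_topology X euclideanreal) (f b)"
      by (cases b) auto
  next
    have f_eq: "f True z = f False z" if z: "z \<in> topspace ?N" "fst z \<in> K" "fst z \<notin> W" for z
    proof -
      obtain y s where ys: "z = (y,s)" by (cases z)
      have y: "y \<in> K" "y \<notin> W"
        using z ys by auto
      note cy = local_collarD[OF y(1)]
      have pos: "1 + \<psi> (\<pi> y) > 0"
        using \<psi>(1)[of "\<pi> y"] cy by auto
      \<comment> \<open>If \<open>t y = 1\<close>, then \<open>y\<close> is off A, so
        \<open>s = 0\<close> and the coordinate is the end 1, which the affine map fixes. Otherwise
        \<open>\<pi> y\<close> is a point of A outside W, where the two heights agree and the affine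
        map is the identity.\<close>
      have "?\<tau> z = t y - s"
      proof (cases "t y = 1")
        case True
        then have "s = 0"
          using cy(8) z ys by (auto simp: topspace_attach_collar)
        then show ?thesis
          using True by (simp add: stretch_coord_def ys)
      next
        case False
        then have "\<psi>' (\<pi> y) = \<psi> (\<pi> y)"
          using cy y eq by blast
        then show ?thesis
          using pos by (simp add: stretch_coord_def ys)
      qed
      then show ?thesis
        using stretch_recover[of y s \<psi>] z(1) y ys by (simp add: f_def)
    qed
    show "f i z = f j z"
      if "z \<in> topspace ?N \<inter> (if i then ?K else ?L) \<inter> (if j then ?K else ?L)" for i j z
      using that f_eq[of z] by (cases i; cases j) auto
    show "\<exists>j. j \<in> UNIV \<and> z \<in> (if j then ?K else ?L) \<and> ?S z = f j z" if z: "z \<in> topspace ?N" for z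
    proof (cases "fst z \<in> K")
      case True
      then show ?thesis
        using z by (intro exI[of _ True]) (simp add: f_def stretch_def)
    next
      case False
      moreover have "fst z \<in> topspace X"
        using z by (auto simp: topspace_attach_collar)
      ultimately show ?thesis
        using z local_collar_subsets by (intro exI[of _ False]) (auto simp: f_def stretch_def)
    qed
  qed auto
  moreover have "?S z \<in> topspace (attach_collar X A \<psi>')" if "z \<in> topspace ?N" for z
    using stretch_in[OF that \<psi> eq] .
  ultimately show ?thesis
    by (auto simp: attach_collar_def continuous_map_in_subtopology)
qed

text \<open>The outer end of each fibre goes to the outer end. This preserves, during the growth of
  the collar, that A is mapped to the outer rim.\<close>

lemma stretch_top:
  assumes "x \<in> A" "0 \<le> \<psi> x" "0 \<le> \<psi>' x" and eq: "\<And>x. x \<in> A - W \<Longrightarrow> \<psi>' x = \<psi> x"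
  shows "stretch K \<pi> t c \<psi> \<psi>' (x, \<psi> x) = (x, \<psi>' x)"
proof (cases "x \<in> K")
  case True
  have "1 + \<psi> x > 0"
    using assms by simp
  then have "stretch_coord \<pi> t \<psi> \<psi>' (x, \<psi> x) = - \<psi>' x"
    using local_collarD[OF True] assms by (simp add: stretch_coord_def)
  then show ?thesis
    using True local_collarD[OF True] local_collar_base[of x] assms by (simp add: stretch_def)
next
  case False
  then have "\<psi>' x = \<psi> x"
    using assms(1) eq local_collar_subsets by blast
  then show ?thesis
    using False by (simp add: stretch_def)
qed

lemma homeomorphic_maps_stretch:
  assumes "continuous_map X euclideanreal \<psi>" "continuous_map X euclideanreal \<psi>'"
    and "\<And>x. x \<in> topspace X \<Longrightarrow> 0 \<le> \<psi> x" "\<And>x. x \<in> topspace X \<Longrightarrow> 0 \<le> \<psi>' x"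
    and eq: "\<And>x. x \<in> A - W \<Longrightarrow> \<psi>' x = \<psi> x"
  shows "homeomorphic_maps (attach_collar X A \<psi>) (attach_collar X A \<psi>')
           (stretch K \<pi> t c \<psi> \<psi>') (stretch K \<pi> t c \<psi>' \<psi>)"
proof -
  have eq': "\<psi> x = \<psi>' x" if "x \<in> A - W" for x
    using eq[OF that] by simp
  show ?thesis
    unfolding homeomorphic_maps_def
  proof (intro conjI ballI)
    show "continuous_map (attach_collar X A \<psi>) (attach_collar X A \<psi>') (stretch K \<pi> t c \<psi> \<psi>')"
      "continuous_map (attach_collar X A \<psi>') (attach_collar X A \<psi>) (stretch K \<pi> t c \<psi>' \<psi>)"
      by (rule continuous_map_stretch[OF assms], assumption+)
        (rule continuous_map_stretch[OF assms(2,1,4,3) eq'], assumption+)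
    show "stretch K \<pi> t c \<psi>' \<psi> (stretch K \<pi> t c \<psi> \<psi>' z) = z"
      if "z \<in> topspace (attach_collar X A \<psi>)" for z
      by (rule stretch_inverse[OF that assms(3,4)])
    show "stretch K \<pi> t c \<psi> \<psi>' (stretch K \<pi> t c \<psi>' \<psi> z) = z"
      if "z \<in> topspace (attach_collar X A \<psi>')" for z
      by (rule stretch_inverse[OF that assms(4,3)])
  qed
qed

end

section \<open>Growing the collar over all of A\<close>

lemma homeomorphic_maps_attach_collar_zero:
  "homeomorphic_maps X (attach_collar X A (\<lambda>x. 0)) (\<lambda>x. (x,0)) fst"
  unfolding homeomorphic_maps_def
proof (intro conjI)
  have "continuous_map X X (\<lambda>x. x)"
    using continuous_map_id by (simp add: id_def)
  then show "continuous_map X (attach_collar X A (\<lambda>x. 0)) (\<lambda>x. (x,0))"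
    by (simp add: attach_collar_def continuous_map_in_subtopology continuous_map_paired)
qed (auto simp: continuous_map_attach_collar_fst topspace_attach_collar)

text \<open>Brown's collaring theorem for compact spaces. \<open>P \<psi>\<close> says that X
  absorbs an external collar of height \<open>\<psi>\<close> with A going to the outer rim. It is
  trivial for height 0, and each chart of a finite cover raises the height by one stretch.\<close>

theorem collar_of_locally_collared:
  assumes X: "compact_space X" "Hausdorff_space X" and A: "closedin X A"
    and loc: "\<And>a. a \<in> A \<Longrightarrow> \<exists>W K \<pi> t c. a \<in> W \<and> local_collar X A W K \<pi> t c"
  obtains G G' where "homeomorphic_maps X (attach_collar X A (\<lambda>x. 1)) G G'"
    "\<And>x. x \<in> A \<Longrightarrow> G x = (x,1)"
proof -
  have AX: "A \<subseteq> topspace X"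
    using A closedin_subset by blast
  have nX: "normal_space X"
    using X compact_Hausdorff_or_regular_imp_normal_space by blast
  define P where "P \<psi> \<longleftrightarrow> (\<exists>G G'. homeomorphic_maps X (attach_collar X A \<psi>) G G' \<and>
      (\<forall>x \<in> A. G x = (x, \<psi> x)))" for \<psi> :: "'a \<Rightarrow> real"
  have bump: "\<exists>W K \<pi> t c \<beta>. local_collar X A W K \<pi> t c \<and> continuous_map X unit_interval \<beta> \<and>
      \<beta> a = 1 \<and> (\<forall>x \<in> topspace X - W. \<beta> x = 0)" if a: "a \<in> A" for a
  proof -
    obtain W K \<pi> t c where W: "a \<in> W" "local_collar X A W K \<pi> t c"
      using loc[OF a] by blast
    have "closedin X (topspace X - W)" "closedin X {a}"
      using W a AX X by (auto simp: local_collar_def closedin_Hausdorff_sing_eq)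
    then obtain \<beta> :: "'a \<Rightarrow> real" where "continuous_map X unit_interval \<beta>"
        "\<beta> ` (topspace X - W) \<subseteq> {0}" "\<beta> ` {a} \<subseteq> {1}"
      using Urysohn_lemma[OF nX, of "topspace X - W" "{a}" 0 1] W by (auto simp: disjnt_def)
    then show ?thesis
      using W by blast
  qed
  then obtain W K \<pi> t c \<beta> where
    lc: "\<And>a. a \<in> A \<Longrightarrow> local_collar X A (W a) (K a) (\<pi> a) (t a) (c a)"
    and \<beta>: "\<And>a. a \<in> A \<Longrightarrow> continuous_map X unit_interval (\<beta> a)"
    and \<beta>1: "\<And>a. a \<in> A \<Longrightarrow> \<beta> a a = 1"
    and \<beta>0: "\<And>a x. a \<in> A \<Longrightarrow> x \<in> topspace X - W a \<Longrightarrow> \<beta> a x = 0"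
    by metis
  have \<beta>c: "continuous_map X euclideanreal (\<beta> a)" if "a \<in> A" for a
    using \<beta>[OF that] continuous_map_into_fulltopology by blast
  have \<beta>_ge: "0 \<le> \<beta> a x" if "a \<in> A" "x \<in> topspace X" for a x
    using \<beta>[OF that(1)] that by (auto simp: continuous_map_in_subtopology)
  \<comment> \<open>These sets already cover A, and \<open>2 * \<beta> a\<close> exceeds 1 on them,
    so a single step reaches full height on all of \<open>U a\<close>.\<close>
  define U where "U a = {x \<in> topspace X. \<beta> a x \<in> {1/2<..}}" for a
  have "openin X (U a)" if "a \<in> A" for a
    unfolding U_def using \<beta>c[OF that] by (rule openin_continuous_map_preimage) auto
  moreover have "A \<subseteq> \<Union>(U ` A)"
    using \<beta>1 AX by (auto simp: U_def)
  moreover have "compactin X A"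
    using A X closedin_compact_space by blast
  ultimately obtain \<F> where \<F>: "finite \<F>" "\<F> \<subseteq> U ` A" "A \<subseteq> \<Union>\<F>"
    unfolding compactin_def by (metis (no_types, lifting) imageE)
  then obtain F where F: "finite F" "F \<subseteq> A" "A \<subseteq> \<Union>(U ` F)"
    by (metis finite_subset_image)
  have "\<exists>\<psi>. continuous_map X euclideanreal \<psi> \<and> (\<forall>x \<in> topspace X. 0 \<le> \<psi> x \<and> \<psi> x \<le> 1) \<and>
      (\<forall>a \<in> F. \<forall>x \<in> U a. \<psi> x = 1) \<and> P \<psi>"
    using F(1,2)
  proof (induction F rule: finite_induct)
    case empty
    have "P (\<lambda>x. 0)"
      unfolding P_def using homeomorphic_maps_attach_collar_zero by fastforce
    then show ?case
      by (intro exI[of _ "\<lambda>x. 0"]) auto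
  next
    case (insert a F)
    then obtain \<psi> G G' where \<psi>: "continuous_map X euclideanreal \<psi>"
        "\<And>x. x \<in> topspace X \<Longrightarrow> 0 \<le> \<psi> x \<and> \<psi> x \<le> 1"
        "\<And>a x. a \<in> F \<Longrightarrow> x \<in> U a \<Longrightarrow> \<psi> x = 1"
        and G: "homeomorphic_maps X (attach_collar X A \<psi>) G G'" "\<And>x. x \<in> A \<Longrightarrow> G x = (x, \<psi> x)"
      by (auto simp: P_def)
    have a: "a \<in> A"
      using insert by auto
    \<comment> \<open>The maximum preserves what earlier charts achieved, the truncation keeps the
      height at most 1, and as \<open>\<beta> a\<close> vanishes off \<open>W a\<close>, the height
      changes only where the stretch allows it.\<close>
    define \<psi>' where "\<psi>' x = max (\<psi> x) (min 1 (2 * \<beta> a x))" for x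
    have c': "continuous_map X euclideanreal \<psi>'"
      unfolding \<psi>'_def by (intro continuous_intros \<psi>(1) \<beta>c[OF a]) auto
    have b': "0 \<le> \<psi>' x \<and> \<psi>' x \<le> 1" if "x \<in> topspace X" for x
      using \<psi>(2)[OF that] by (auto simp: \<psi>'_def)
    have eq: "\<psi>' x = \<psi> x" if "x \<in> A - W a" for x
      using \<beta>0[OF a, of x] \<psi>(2)[of x] that AX by (auto simp: \<psi>'_def)
    have one: "\<psi>' x = 1" if "b \<in> insert a F" "x \<in> U b" for b x
      using that \<psi>(2)[of x] \<psi>(3)[of b x] by (auto simp: \<psi>'_def U_def)
    let ?S = "stretch (K a) (\<pi> a) (t a) (c a)"
    have "homeomorphic_maps (attach_collar X A \<psi>) (attach_collar X A \<psi>') (?S \<psi> \<psi>') (?S \<psi>' \<psi>)"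
      using \<psi>(2) b' by (intro homeomorphic_maps_stretch[OF lc[OF a]] \<psi>(1) c' eq) auto
    then have "homeomorphic_maps X (attach_collar X A \<psi>') (?S \<psi> \<psi>' \<circ> G) (G' \<circ> ?S \<psi>' \<psi>)"
      using G(1) homeomorphic_maps_compose by blast
    moreover have "(?S \<psi> \<psi>' \<circ> G) x = (x, \<psi>' x)" if "x \<in> A" for x
      using stretch_top[OF lc[OF a] that, of \<psi> \<psi>'] eq \<psi>(2)[of x] b'[of x] that AX G(2) by auto
    ultimately have "P \<psi>'"
      unfolding P_def by blast
    then show ?case
      using c' b' one by blast
  qed
  then obtain \<psi> G G' where \<psi>: "\<And>a x. a \<in> F \<Longrightarrow> x \<in> U a \<Longrightarrow> \<psi> x = 1"
      and G: "homeomorphic_maps X (attach_collar X A \<psi>) G G'" "\<And>x. x \<in> A \<Longrightarrow> G x = (x, \<psi> x)"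
    unfolding P_def by metis
  have \<psi>1: "\<psi> x = 1" if "x \<in> A" for x
    using that F(3) \<psi> by blast
  \<comment> \<open>Off A the final height may differ from 1, but \<open>attach_collar\<close> sees
    the height on A only.\<close>
  then have "attach_collar X A \<psi> = attach_collar X A (\<lambda>x. 1)"
    unfolding attach_collar_def by (intro arg_cong[where f = "subtopology _"]) auto
  then show ?thesis
    using that G \<psi>1 by simp
qed

text \<open>A point sent to height 1 has the same image as some point of A, hence by injectivity is
  that point. So the complement of A corresponds to the heights below 1.\<close>

lemma complement_homeomorphic_open_cylinder:
  assumes G: "homeomorphic_maps X (attach_collar X A (\<lambda>x. 1)) G G'"
    and GA: "\<And>x. x \<in> A \<Longrightarrow> G x = (x,1)" and A: "A \<subseteq> topspace X"
  shows "subtopology X (topspace X - A) homeomorphic_space open_cylinder X A"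
proof -
  let ?N = "attach_collar X A (\<lambda>x. 1)" and ?T = "{z::'a \<times> real. snd z < 1}"
  have inv: "G' (G x) = x" if "x \<in> topspace X" for x
    using G that by (simp add: homeomorphic_maps_def)
  have inv': "G (G' z) = z" if "z \<in> topspace ?N" for z
    using G that by (simp add: homeomorphic_maps_def)
  have GN: "G x \<in> topspace ?N" if "x \<in> topspace X" for x
    using G that by (auto simp: homeomorphic_maps_def continuous_map_def)
  have G'X: "G' z \<in> topspace X" if "z \<in> topspace ?N" for z
    using G that by (auto simp: homeomorphic_maps_def continuous_map_def)
  have "homeomorphic_maps (subtopology X (topspace X - A)) (subtopology ?N ?T) G G'"
  proof (rule homeomorphic_maps_subtopologies_alt[OF G])
    show "G ` (topspace X \<inter> (topspace X - A)) \<subseteq> ?T"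
    proof clarsimp
      fix x assume x: "x \<in> topspace X" "x \<notin> A"
      show "snd (G x) < 1"
      proof (rule ccontr)
        assume "\<not> snd (G x) < 1"
        then have "G x = (fst (G x), 1)" "fst (G x) \<in> A"
          using GN[OF x(1)] by (auto simp: topspace_attach_collar)
        then have "G x = G (fst (G x))"
          using GA by metis
        then have "x = fst (G x)"
          using inv x A \<open>fst (G x) \<in> A\<close> by (metis subsetD)
        then show False
          using x \<open>fst (G x) \<in> A\<close> by simp
      qed
    qed
    show "G' ` (topspace ?N \<inter> ?T) \<subseteq> topspace X - A"
    proof
      fix x assume "x \<in> G' ` (topspace ?N \<inter> ?T)"
      then obtain z where z: "x = G' z" "z \<in> topspace ?N" "snd z < 1" by auto
      have "x \<notin> A"
        using GA[of x] inv'[OF z(2)] z by (metis less_irrefl snd_conv)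
      then show "x \<in> topspace X - A"
        using G'X z by blast
    qed
  qed
  moreover have "subtopology ?N ?T = open_cylinder X A"
    unfolding attach_collar_def open_cylinder_def subtopology_subtopology
    by (intro arg_cong[where f = "subtopology _"]) auto
  ultimately show ?thesis
    unfolding homeomorphic_space_def by auto
qed

section \<open>Manifold boundaries\<close>

lemma openin_Euclidean_space_iff:
  "openin (Euclidean_space n) S \<longleftrightarrow> (\<exists>T. open T \<and> S = T \<inter> {x. \<forall>i\<ge>n. x i = 0})"
  by (simp add: Euclidean_space_def openin_subtopology euclidean_product_topology)

lemma openin_Euclidean_halfspace_iff:
  "openin (Euclidean_halfspace n) S \<longleftrightarrow>
     (\<exists>T. open T \<and> S = T \<inter> {x. (\<forall>i\<ge>n. x i = 0) \<and> 0 \<le> x 0})"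
proof -
  have "Euclidean_halfspace n = subtopology (powertop_real UNIV) {x. (\<forall>i\<ge>n. x i = 0) \<and> 0 \<le> x 0}"
    unfolding Euclidean_halfspace_def Euclidean_space_def subtopology_subtopology
    by (intro arg_cong[where f = "subtopology _"]) auto
  then show ?thesis
    by (simp add: openin_subtopology euclidean_product_topology)
qed

lemma topspace_Euclidean_halfspace:
  "topspace (Euclidean_halfspace n) = {x. (\<forall>i\<ge>n. x i = 0) \<and> 0 \<le> x 0}"
  by (auto simp: Euclidean_halfspace_def topspace_Euclidean_space)

lemma continuous_map_into_Euclidean_halfspace:
  assumes "\<And>i. continuous_map Z euclideanreal (\<lambda>z. f z i)"
    and "\<And>z. z \<in> topspace Z \<Longrightarrow> f z \<in> topspace (Euclidean_halfspace n)"
  shows "continuous_map Z (Euclidean_halfspace n) f"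
  using assms unfolding topspace_Euclidean_halfspace
  unfolding Euclidean_halfspace_def Euclidean_space_def
  by (auto simp: continuous_map_in_subtopology continuous_map_componentwise_UNIV)

lemma continuous_map_Euclidean_halfspace_coord:
  "continuous_map (Euclidean_halfspace n) euclideanreal (\<lambda>x. x i)"
  unfolding Euclidean_halfspace_def Euclidean_space_def
  by (intro continuous_map_from_subtopology continuous_map_product_projection) auto

lemma open_contains_cube:
  fixes T :: "(nat \<Rightarrow> real) set"
  assumes "open T" "a \<in> T" "\<forall>i\<ge>n. a i = 0"
  obtains r where "0 < r" "\<And>x. \<forall>i<n. \<bar>x i - a i\<bar> \<le> r \<Longrightarrow> \<forall>i\<ge>n. x i = 0 \<Longrightarrow> x \<in> T"
proof -
  have "openin (powertop_real UNIV) T"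
    using assms by (simp add: euclidean_product_topology)
  then obtain B where B: "a \<in> Pi\<^sub>E UNIV B" "\<And>i. openin euclideanreal (B i)" "Pi\<^sub>E UNIV B \<subseteq> T"
    using product_topology_open_contains_basis[OF _ assms(2)] by blast
  have "\<exists>e>0. cball (a i) e \<subseteq> B i" for i
    using B(1) B(2)[of i] by (auto simp: open_contains_cball)
  then obtain e where e: "\<And>i. 0 < e i" "\<And>i. cball (a i) (e i) \<subseteq> B i"
    by metis
  \<comment> \<open>Coordinates from \<open>n\<close> on are pinned to 0, so only finitely many
    radii count. The 1 keeps the set nonempty when \<open>n = 0\<close>.\<close>
  define r where "r = Min (insert 1 (e ` {..<n}))"
  have r: "0 < r" "\<And>i. i < n \<Longrightarrow> r \<le> e i"
    using e(1) by (auto simp: r_def)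
  have "x \<in> T" if x: "\<forall>i<n. \<bar>x i - a i\<bar> \<le> r" "\<forall>i\<ge>n. x i = 0" for x
  proof -
    have "x i \<in> cball (a i) (e i)" for i
    proof (cases "i < n")
      case True
      then show ?thesis
        using x(1) r(2)[OF True] by (force simp: dist_real_def abs_minus_commute)
    next
      case False
      then show ?thesis
        using x(2) assms(3) e(1)[of i] by (simp add: less_imp_le)
    qed
    then have "x \<in> Pi\<^sub>E UNIV B"
      using e(2) by (intro PiE_I) (auto simp del: mem_cball)
    then show ?thesis
      using B(3) by blast
  qed
  then show ?thesis
    using that r(1) by blast
qed

text \<open>Were coordinate 0 not positive, lowering it slightly would stay in the open set and
  leave the half-space. With \<open>0 < n\<close>, coordinate 0 is free to move.\<close>

lemma open_Euclidean_subset_halfspace_pos: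
  assumes "openin (Euclidean_space n) S" "0 < n" "\<And>x. x \<in> S \<Longrightarrow> 0 \<le> x 0" "a \<in> S"
  shows "0 < a 0"
proof -
  obtain T where T: "open T" "S = T \<inter> {x. \<forall>i\<ge>n. x i = 0}"
    using assms(1) unfolding openin_Euclidean_space_iff by (elim exE conjE)
  then obtain r where r: "0 < r"
      "\<And>x. \<forall>i<n. \<bar>x i - a i\<bar> \<le> r \<Longrightarrow> \<forall>i\<ge>n. x i = 0 \<Longrightarrow> x \<in> T"
    using open_contains_cube[of T a n] assms(4) by auto
  have "a(0 := a 0 - r) \<in> S"
    using r T(2) assms(2,4) by auto
  then show ?thesis
    using assms(3)[of "a(0 := a 0 - r)"] r(1) by simp
qed

text \<open>By definition an interior point has some Euclidean chart; a priori it could also lie on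
  the face of a half-space chart. Invariance of domain excludes this: the Euclidean chart would give
  an open subset of Euclidean space inside the half-space and touching its face. Conversely, away
  from the face a half-space chart restricts to a Euclidean one.\<close>

lemma chart_interior_iff:
  assumes n: "0 < n" and U: "openin X U" and V: "openin (Euclidean_halfspace n) V"
    and h: "homeomorphic_maps (subtopology X U) (subtopology (Euclidean_halfspace n) V) h h'"
    and y: "y \<in> U"
  shows "y \<in> manifold_interior n X \<longleftrightarrow> 0 < h y 0"
proof
  let ?H = "Euclidean_halfspace n" and ?E = "Euclidean_space n"
  have UX: "U \<subseteq> topspace X" and VH: "V \<subseteq> topspace ?H"
    using U V openin_subset by blast+
  have hc: "continuous_map (subtopology X U) (subtopology ?H V) h"
    using h by (simp add: homeomorphic_maps_def)
  have hV: "h x \<in> V" if "x \<in> U" for x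
    using hc that UX by (auto simp: continuous_map_def)
  {
    assume "0 < h y 0"
    define U' where "U' = {x \<in> topspace (subtopology X U). h x \<in> V \<inter> {x. 0 < x 0}}"
    define V' where "V' = V \<inter> {x. 0 < x 0}"
    obtain T where T: "open T" "V = T \<inter> {x. (\<forall>i\<ge>n. x i = 0) \<and> 0 \<le> x 0}"
      using V unfolding openin_Euclidean_halfspace_iff by (elim exE conjE)
    have o: "open {x::nat \<Rightarrow> real. 0 < x 0}"
      by (intro open_Collect_less continuous_intros continuous_on_product_coordinates)
    have "V' = (T \<inter> {x. 0 < x 0}) \<inter> {x. \<forall>i\<ge>n. x i = 0}"
      using T by (auto simp: V'_def)
    then have V'E: "openin ?E V'"
      unfolding openin_Euclidean_space_iff using T(1) o by blast
    have "V' = (T \<inter> {x. 0 < x 0}) \<inter> {x. (\<forall>i\<ge>n. x i = 0) \<and> 0 \<le> x 0}"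
      using T by (auto simp: V'_def)
    then have "openin ?H V'"
      unfolding openin_Euclidean_halfspace_iff using T(1) o by blast
    then have V'H: "openin (subtopology ?H V) V'"
      by (auto simp: openin_subtopology V'_def)
    have "openin (subtopology X U) U'"
      using openin_continuous_map_preimage[OF hc V'H] by (simp add: U'_def V'_def)
    then have U': "openin X U'"
      using U openin_trans_full by blast
    have "homeomorphic_maps (subtopology (subtopology X U) U') (subtopology (subtopology ?H V) V') h h'"
    proof (rule homeomorphic_maps_subtopologies_alt[OF h])
      show "h ` (topspace (subtopology X U) \<inter> U') \<subseteq> V'"
        by (auto simp: U'_def V'_def)
      show "h' ` (topspace (subtopology ?H V) \<inter> V') \<subseteq> U'"
      proof (clarsimp simp: U'_def V'_def)
        fix x assume x: "x \<in> topspace ?H" "x \<in> V" "0 < x 0"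
        then have "h' x \<in> topspace (subtopology X U)" "h (h' x) = x"
          using h by (auto simp: homeomorphic_maps_def continuous_map_def)
        then show "h' x \<in> topspace X \<and> h' x \<in> U \<and> h (h' x) \<in> V \<and> 0 < h (h' x) 0"
          using x by simp
      qed
    qed
    moreover have "subtopology (subtopology X U) U' = subtopology X U'"
      unfolding subtopology_subtopology
      by (intro arg_cong[where f = "subtopology _"]) (auto simp: U'_def)
    moreover have "subtopology (subtopology ?H V) V' = subtopology ?E V'"
      unfolding Euclidean_halfspace_def subtopology_subtopology
      by (intro arg_cong[where f = "subtopology _"]) (auto simp: V'_def)
    ultimately have "subtopology X U' homeomorphic_space subtopology ?E V'"
      by (auto simp: homeomorphic_space_def)
    moreover have "y \<in> U'"
      using y UX hV \<open>0 < h y 0\<close> by (auto simp: U'_def)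
    ultimately show "y \<in> manifold_interior n X"
      unfolding manifold_interior_def using U' V'E y UX by blast
  next
    assume "y \<in> manifold_interior n X"
    then obtain U2 V2 k k' where U2: "openin X U2" "y \<in> U2" and V2: "openin ?E V2"
      and k: "homeomorphic_maps (subtopology X U2) (subtopology ?E V2) k k'"
      by (auto simp: manifold_interior_def homeomorphic_space_def)
    have U2X: "U2 \<subseteq> topspace X" and V2E: "V2 \<subseteq> topspace ?E"
      using U2 V2 openin_subset by blast+
    \<comment> \<open>On \<open>W\<close> the transition map \<open>h \<circ> k'\<close> is defined.
      Regarded as a map into the whole Euclidean space, it is injective and continuous, hence
      open.\<close>
    define W where "W = {x \<in> topspace (subtopology ?E V2). k' x \<in> U}"
    have k'c: "continuous_map (subtopology ?E V2) (subtopology X U2) k'"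
      using k by (simp add: homeomorphic_maps_def)
    have "openin (subtopology ?E V2) W"
      unfolding W_def
      using k'c U by (intro openin_continuous_map_preimage[of _ X]) (auto simp: continuous_map_in_subtopology)
    then have W: "openin ?E W"
      using V2 openin_trans_full by blast
    have WV2: "W \<subseteq> V2"
      by (auto simp: W_def)
    have "continuous_map (subtopology ?E W) (subtopology X U) k'"
      using continuous_map_from_subtopology_mono[OF continuous_map_into_fulltopology[OF k'c] WV2]
      by (auto simp: continuous_map_in_subtopology W_def)
    from continuous_map_compose[OF this hc]
    have "continuous_map (subtopology ?E W) ?E (h \<circ> k')"
      by (simp add: continuous_map_in_subtopology Euclidean_halfspace_def)
    moreover have "inj_on (h \<circ> k') W"
    proof (rule inj_on_inverseI[where g = "k \<circ> h'"])
      fix x assume x: "x \<in> W"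
      then have "k' x \<in> topspace (subtopology X U)" "x \<in> topspace (subtopology ?E V2)"
        using UX by (auto simp: W_def)
      then show "(k \<circ> h') ((h \<circ> k') x) = x"
        using h k by (simp add: homeomorphic_maps_def)
    qed
    ultimately have o: "openin ?E ((h \<circ> k') ` W)"
      using invariance_of_domain_Euclidean_space[OF W] by blast
    have "y \<in> topspace (subtopology X U2)"
      using U2 U2X by auto
    then have ky: "k' (k y) = y" "k y \<in> topspace (subtopology ?E V2)"
      using k by (auto simp: homeomorphic_maps_def continuous_map_def)
    then have "h y \<in> (h \<circ> k') ` W"
      using y by (intro image_eqI[where x = "k y"]) (auto simp: W_def)
    moreover have "0 \<le> x 0" if "x \<in> (h \<circ> k') ` W" for x
      using that hV VH by (force simp: W_def topspace_Euclidean_halfspace)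
    ultimately show "0 < h y 0"
      using open_Euclidean_subset_halfspace_pos[OF o n] by blast
  }
qed

section \<open>The boundary is closed and locally collared\<close>

lemma manifold_interior_subset: "manifold_interior n X \<subseteq> topspace X"
  by (auto simp: manifold_interior_def)

lemma openin_manifold_interior: "openin X (manifold_interior n X)"
proof (subst openin_subopen, intro ballI)
  fix x assume "x \<in> manifold_interior n X"
  then obtain U V where UV: "openin X U" "x \<in> U" "openin (Euclidean_space n) V"
      "subtopology X U homeomorphic_space subtopology (Euclidean_space n) V"
    by (auto simp: manifold_interior_def)
  then have "U \<subseteq> manifold_interior n X"
    using openin_subset[OF UV(1)] unfolding manifold_interior_def by blast
  then show "\<exists>T. openin X T \<and> x \<in> T \<and> T \<subseteq> manifold_interior n X"
    using UV by blast
qed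

lemma closedin_manifold_boundary: "closedin X (manifold_boundary n X)"
  by (simp add: manifold_boundary_def openin_manifold_interior closedin_diff)

text \<open>In a half-space chart, a cube resting on the face is a product of its bottom with an
  interval: \<open>\<pi>\<close> sets coordinate 0 to 0, and \<open>t\<close> is that coordinate
  rescaled by the side length.\<close>

lemma manifold_boundary_local_collar:
  assumes n: "0 < n" and X: "topological_manifold n X"
    and p: "p \<in> manifold_boundary n X"
  shows "\<exists>W K \<pi> t c. p \<in> W \<and> local_collar X (manifold_boundary n X) W K \<pi> t c"
proof -
  let ?H = "Euclidean_halfspace n" and ?B = "manifold_boundary n X"
  have pX: "p \<in> topspace X"
    using p by (simp add: manifold_boundary_def)
  then obtain U V where U: "openin X U" "p \<in> U" and V: "openin ?H V"
    and "subtopology X U homeomorphic_space subtopology ?H V"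
    using X by (auto simp: topological_manifold_def)
  then obtain h h' where h: "homeomorphic_maps (subtopology X U) (subtopology ?H V) h h'"
    by (auto simp: homeomorphic_space_def)
  have UX: "U \<subseteq> topspace X" and VH: "V \<subseteq> topspace ?H"
    using U V openin_subset by blast+
  have hc: "continuous_map (subtopology X U) (subtopology ?H V) h"
    and h'c: "continuous_map (subtopology ?H V) (subtopology X U) h'"
    using h by (auto simp: homeomorphic_maps_def)
  have hV: "h x \<in> V" and h'h: "h' (h x) = x" if "x \<in> U" for x
    using h that UX by (auto simp: homeomorphic_maps_def continuous_map_def)
  have h'U: "h' x \<in> U" and hh': "h (h' x) = x" if "x \<in> V" for x
    using h that VH by (auto simp: homeomorphic_maps_def continuous_map_def)
  have Vpos: "0 \<le> x 0" "\<forall>i\<ge>n. x i = 0" if "x \<in> V" for x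
    using that VH by (auto simp: topspace_Euclidean_halfspace)
  have B_iff: "y \<in> ?B \<longleftrightarrow> h y 0 = 0" if "y \<in> U" for y
    using chart_interior_iff[OF n U(1) V h that] Vpos(1)[OF hV[OF that]] that UX
    by (auto simp: manifold_boundary_def)
  define a where "a = h p"
  have a: "a \<in> V" "a 0 = 0"
    using hV U B_iff p by (auto simp: a_def)
  obtain T where T: "open T" "V = T \<inter> {x. (\<forall>i\<ge>n. x i = 0) \<and> 0 \<le> x 0}"
    using V unfolding openin_Euclidean_halfspace_iff by (elim exE conjE)
  have "a \<in> T"
    using a T(2) by blast
  obtain r where r: "0 < r"
      "\<And>x. \<forall>i<n. \<bar>x i - a i\<bar> \<le> r \<Longrightarrow> \<forall>i\<ge>n. x i = 0 \<Longrightarrow> x \<in> T"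
    using open_contains_cube[OF T(1) \<open>a \<in> T\<close> Vpos(2)[OF a(1)]] by blast
  \<comment> \<open>\<open>Q\<close> is the cube with its sides, which becomes K; \<open>Q'\<close>
    omits the sides and the top, to become the open set W. Since \<open>a 0 = 0\<close>, coordinate
    0 runs through \<open>{0..r}\<close> on \<open>Q\<close>.\<close>
  define Q where "Q = {x. (\<forall>i<n. \<bar>x i - a i\<bar> \<le> r) \<and> (\<forall>i\<ge>n. x i = 0) \<and> 0 \<le> x 0}"
  define Q' where "Q' = {x \<in> V. \<forall>i<n. \<bar>x i - a i\<bar> < r}"
  have QV: "Q \<subseteq> V"
    using r(2) T(2) by (auto simp: Q_def)
  have Q'Q: "Q' \<subseteq> Q"
    using Vpos by (force simp: Q_def Q'_def)
  have Q0: "0 \<le> x 0" "x 0 \<le> r" if "x \<in> Q" for x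
    using that n a(2) by (auto simp: Q_def)
  have Q_upd: "x(0 := v) \<in> Q" if "x \<in> Q" "0 \<le> v" "v \<le> r" for x v
    using that a(2) n by (auto simp: Q_def)
  have Q_compact: "compactin (subtopology ?H V) Q"
  proof -
    \<comment> \<open>Writing the cube as a product of intervals, with \<open>{0}\<close> in the
      coordinates from \<open>n\<close> on, gives compactness from that of the factors.\<close>
    let ?F = "\<lambda>i. if i = 0 then {0..r} else if i < n then {a i - r..a i + r} else {0}"
    have "x \<in> Q \<longleftrightarrow> (\<forall>i. x i \<in> ?F i)" for x
    proof
      assume x: "x \<in> Q"
      show "\<forall>i. x i \<in> ?F i"
        using Q0[OF x] x by (auto simp: Q_def abs_le_iff)
    next
      assume x: "\<forall>i. x i \<in> ?F i"
      have "\<bar>x i - a i\<bar> \<le> r" if "i < n" for i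
        using x[rule_format, of i] that a(2) by (auto simp: abs_le_iff split: if_splits)
      moreover have "x i = 0" if "i \<ge> n" for i
        using x[rule_format, of i] that n by (auto split: if_splits)
      moreover have "0 \<le> x 0"
        using x[rule_format, of 0] by auto
      ultimately show "x \<in> Q"
        by (auto simp: Q_def)
    qed
    then have "Q = Pi\<^sub>E UNIV ?F"
      by (auto simp: PiE_UNIV_domain)
    moreover have "compactin (powertop_real UNIV) (Pi\<^sub>E UNIV ?F)"
      by (auto simp: compactin_PiE)
    ultimately have "compactin (powertop_real UNIV) Q"
      by simp
    moreover have "Q \<subseteq> {x. \<forall>i\<ge>n. x i = 0}" "Q \<subseteq> {x. 0 \<le> x 0}"
      by (auto simp: Q_def)
    ultimately show ?thesis
      using QV by (simp add: Euclidean_halfspace_def Euclidean_space_def compactin_subtopology)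
  qed
  have Q'_open: "openin (subtopology ?H V) Q'"
  proof -
    have "open {x::nat \<Rightarrow> real. \<bar>x i - a i\<bar> < r}" for i
      by (intro open_Collect_less continuous_intros continuous_on_product_coordinates)
    then have "open (\<Inter>i\<in>{..<n}. {x::nat \<Rightarrow> real. \<bar>x i - a i\<bar> < r})"
      by (intro open_INT) auto
    moreover have "Q' = (T \<inter> (\<Inter>i\<in>{..<n}. {x::nat \<Rightarrow> real. \<bar>x i - a i\<bar> < r})) \<inter>
        {x. (\<forall>i\<ge>n. x i = 0) \<and> 0 \<le> x 0}"
      using T(2) by (auto simp: Q'_def)
    ultimately have "openin ?H Q'"
      unfolding openin_Euclidean_halfspace_iff using T(1) by blast
    then show ?thesis
      by (auto simp: openin_subtopology Q'_def)
  qed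
  define K where "K = h' ` Q"
  define W where "W = {y \<in> topspace (subtopology X U). h y \<in> Q'}"
  define t where "t y = h y 0 / r" for y
  define \<pi> where "\<pi> y = h' ((h y)(0 := 0))" for y
  define c where "c z = h' ((h (fst z))(0 := r * snd z))" for z
  have K_iff: "y \<in> K \<longleftrightarrow> y \<in> U \<and> h y \<in> Q" for y
  proof
    assume "y \<in> K"
    then obtain x where "x \<in> Q" "y = h' x"
      by (auto simp: K_def)
    then show "y \<in> U \<and> h y \<in> Q"
      using h'U[of x] hh'[of x] QV by auto
  next
    assume "y \<in> U \<and> h y \<in> Q"
    then show "y \<in> K"
      unfolding K_def using h'h[of y] by (intro image_eqI[where x = "h y"]) auto
  qed
  have KU: "K \<subseteq> U"
    using K_iff by blast
  have W_iff: "y \<in> W \<longleftrightarrow> y \<in> U \<and> h y \<in> Q'" for y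
    using UX by (auto simp: W_def)
  have "openin (subtopology X U) W"
    unfolding W_def using hc Q'_open by (rule openin_continuous_map_preimage)
  then have Wo: "openin X W"
    using U openin_trans_full by blast
  \<comment> \<open>Closedness within the chart domain would not give closedness in X. Compactness
    does not depend on the surrounding space, and X is Hausdorff.\<close>
  have "compactin (subtopology X U) K"
    unfolding K_def by (rule image_compactin[OF Q_compact h'c])
  then have Kc: "closedin X K"
    using X compactin_imp_closedin by (auto simp: compactin_subtopology topological_manifold_def)
  have coord: "continuous_map (subtopology X K) euclideanreal (\<lambda>y. h y i)" for i
  proof -
    have "continuous_map (subtopology X U) ?H h"
      using hc continuous_map_into_fulltopology by blast
    from continuous_map_compose[OF this continuous_map_Euclidean_halfspace_coord[of n i]]
    have "continuous_map (subtopology X U) euclideanreal (\<lambda>y. h y i)"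
      by (simp add: o_def)
    then show ?thesis
      using continuous_map_from_subtopology_mono KU by blast
  qed
  have into: "continuous_map Z X (\<lambda>z. h' (f z))"
    if "\<And>i. continuous_map Z euclideanreal (\<lambda>z. f z i)" "\<And>z. z \<in> topspace Z \<Longrightarrow> f z \<in> Q"
    for Z :: "'z topology" and f
  proof -
    have "continuous_map Z (subtopology ?H V) f"
      using that QV VH by (auto simp: continuous_map_in_subtopology intro!: continuous_map_into_Euclidean_halfspace)
    from continuous_map_compose[OF this h'c] show ?thesis
      by (simp add: o_def continuous_map_in_subtopology)
  qed
  have \<pi>c: "continuous_map (subtopology X K) X \<pi>"
    unfolding \<pi>_def
  proof (rule into)
    show "continuous_map (subtopology X K) euclideanreal (\<lambda>y. ((h y)(0 := 0)) i)" for i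
      using coord[of i] by (cases "i = 0") auto
    show "(h y)(0 := 0) \<in> Q" if "y \<in> topspace (subtopology X K)" for y
      using that K_iff Q_upd[of "h y" 0] r(1) by auto
  qed
  have tc: "continuous_map (subtopology X K) euclideanreal t"
    unfolding t_def using r(1) by (intro continuous_intros coord) auto
  let ?P = "prod_topology (subtopology X (?B \<inter> K)) unit_interval"
  have cc: "continuous_map ?P X c"
    unfolding c_def
  proof (rule into)
    have "continuous_map ?P (subtopology X (?B \<inter> K)) fst"
      by (rule continuous_map_fst)
    then have f: "continuous_map ?P (subtopology X K) fst"
      by (auto simp: continuous_map_in_subtopology)
    have s: "continuous_map ?P euclideanreal snd"
      using continuous_map_snd continuous_map_into_fulltopology by blast
    show "continuous_map ?P euclideanreal (\<lambda>z. ((h (fst z))(0 := r * snd z)) i)" for i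
      using continuous_map_compose[OF f coord[of i]] s
      by (cases "i = 0") (auto simp: o_def intro!: continuous_intros)
    show "(h (fst z))(0 := r * snd z) \<in> Q" if "z \<in> topspace ?P" for z
    proof (rule Q_upd)
      show "h (fst z) \<in> Q"
        using that K_iff[of "fst z"] by (simp add: mem_Times_iff)
      have "0 \<le> snd z" "snd z \<le> 1"
        using that by (simp_all add: mem_Times_iff)
      then show "0 \<le> r * snd z" "r * snd z \<le> r"
        using r(1) by (simp_all add: mult_left_le)
    qed
  qed
  have \<pi>K: "\<pi> y \<in> ?B \<inter> K" "h (\<pi> y) = (h y)(0 := 0)" if "y \<in> K" for y
  proof -
    have q: "(h y)(0 := 0) \<in> Q"
      using that K_iff Q_upd[of "h y" 0] r(1) by auto
    then show e: "h (\<pi> y) = (h y)(0 := 0)"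
      using hh' QV by (auto simp: \<pi>_def)
    have "\<pi> y \<in> U"
      using q h'U QV by (auto simp: \<pi>_def)
    then show "\<pi> y \<in> ?B \<inter> K"
      using q e K_iff B_iff by simp
  qed
  have 1: "\<forall>y \<in> K. \<pi> y \<in> ?B \<inter> K \<and> 0 \<le> t y \<and> t y \<le> 1 \<and> c (\<pi> y, t y) = y"
  proof
    fix y assume y: "y \<in> K"
    then have "h y \<in> Q" "y \<in> U"
      using K_iff by auto
    moreover have "c (\<pi> y, t y) = y"
      using \<pi>K[OF y] r(1) h'h[OF \<open>y \<in> U\<close>] by (simp add: c_def t_def)
    ultimately show "\<pi> y \<in> ?B \<inter> K \<and> 0 \<le> t y \<and> t y \<le> 1 \<and> c (\<pi> y, t y) = y"
      using \<pi>K[OF y] Q0[of "h y"] r(1) by (simp add: t_def)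
  qed
  have 2: "\<forall>x \<in> ?B \<inter> K. \<forall>u \<in> {0..1}. c (x,u) \<in> K \<and> \<pi> (c (x,u)) = x \<and> t (c (x,u)) = u"
  proof (intro ballI)
    fix x u assume x: "x \<in> ?B \<inter> K" and u: "u \<in> {0..1::real}"
    have xU: "x \<in> U" "h x \<in> Q" "h x 0 = 0"
      using x K_iff B_iff by auto
    have q: "(h x)(0 := r * u) \<in> Q"
      using xU u r(1) by (intro Q_upd) (auto simp: mult_left_le)
    then have hcx: "h (c (x,u)) = (h x)(0 := r * u)" and "c (x,u) \<in> U"
      using hh' h'U QV by (auto simp: c_def)
    moreover have "(h x)(0 := 0) = h x"
      using xU(3) by auto
    ultimately show "c (x,u) \<in> K \<and> \<pi> (c (x,u)) = x \<and> t (c (x,u)) = u"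
      using q K_iff h'h[OF xU(1)] r(1) by (simp add: \<pi>_def t_def)
  qed
  have 3: "\<forall>x \<in> ?B \<inter> K. \<pi> x = x \<and> t x = 0"
  proof
    fix x assume "x \<in> ?B \<inter> K"
    then have xU: "x \<in> U" "h x 0 = 0"
      using K_iff B_iff by auto
    then have "(h x)(0 := 0) = h x"
      by auto
    then show "\<pi> x = x \<and> t x = 0"
      using h'h[OF xU(1)] xU(2) by (simp add: \<pi>_def t_def)
  qed
  have 4: "\<forall>y \<in> K - W. t y = 1 \<or> \<pi> y \<notin> W"
  proof
    fix y assume y: "y \<in> K - W"
    then have yU: "y \<in> U" "h y \<in> Q" "h y \<in> V"
      using K_iff QV by auto
    then obtain i where i: "i < n" "\<not> \<bar>h y i - a i\<bar> < r"
      using y W_iff by (auto simp: Q'_def)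
    \<comment> \<open>A point on the rim of the cube has a coordinate at distance \<open>r\<close>
      from that of the centre. For coordinate 0 this is the top, where \<open>t\<close> is 1; any
      other coordinate is unchanged by \<open>\<pi>\<close>, so \<open>\<pi> y\<close> is on the rim
      as well.\<close>
    show "t y = 1 \<or> \<pi> y \<notin> W"
    proof (cases "i = 0")
      case True
      then have "h y 0 = r"
        using i(2) Q0[OF yU(2)] a(2) by simp
      then show ?thesis
        using r(1) by (simp add: t_def)
    next
      case False
      then have "h (\<pi> y) \<notin> Q'"
        using \<pi>K(2)[of y] y i by (auto simp: Q'_def intro!: exI[of _ i])
      then show ?thesis
        using W_iff by blast
    qed
  qed
  have "p \<in> W"
    using U a r(1) by (auto simp: W_iff Q'_def a_def)
  moreover have "W \<subseteq> K"
    using W_iff K_iff Q'Q by blast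
  ultimately show ?thesis
    unfolding local_collar_def using Wo Kc \<pi>c tc cc 1 2 3 4 by blast
qed

lemma manifold_interior_homeomorphic_open_cylinder:
  assumes "0 < n" "topological_manifold n X" "compact_space X"
  shows "subtopology X (manifold_interior n X) homeomorphic_space
           open_cylinder X (manifold_boundary n X)"
proof -
  have X: "Hausdorff_space X"
    using assms by (simp add: topological_manifold_def)
  obtain G G' where "homeomorphic_maps X (attach_collar X (manifold_boundary n X) (\<lambda>x. 1)) G G'"
    "\<And>x. x \<in> manifold_boundary n X \<Longrightarrow> G x = (x,1)"
    using collar_of_locally_collared[OF assms(3) X closedin_manifold_boundary]
      manifold_boundary_local_collar[OF assms(1,2)] by metis
  moreover have "manifold_boundary n X \<subseteq> topspace X"
    by (auto simp: manifold_boundary_def)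
  ultimately have "subtopology X (topspace X - manifold_boundary n X) homeomorphic_space
      open_cylinder X (manifold_boundary n X)"
    by (rule complement_homeomorphic_open_cylinder)
  moreover have "topspace X - manifold_boundary n X = manifold_interior n X"
    using manifold_interior_subset[of n X] by (auto simp: manifold_boundary_def)
  ultimately show ?thesis
    by simp
qed

text \<open>The nonemptiness hypotheses are part of contractibility in the usual sense:
  \<open>contractible_space\<close> also holds for the empty topology. Collars turn both interiors
  into open cylinders, whose ends are compared.\<close>

theorem corollary3:
  fixes C0 :: "'a topology" and C1 :: "'b topology" and n :: nat
  assumes "n \<ge> 2"
    and "topological_manifold n C0" "compact_space C0" "contractible_space C0" "topspace C0 \<noteq> {}"
    and "topological_manifold n C1" "compact_space C1" "contractible_space C1" "topspace C1 \<noteq> {}"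
  shows "properly_homotopy_equivalent_space
           (subtopology C0 (manifold_interior n C0)) (subtopology C1 (manifold_interior n C1))
         \<longleftrightarrow>
         subtopology C0 (manifold_boundary n C0) homotopy_equivalent_space
           subtopology C1 (manifold_boundary n C1)"
proof -
  let ?I0 = "subtopology C0 (manifold_interior n C0)" and ?I1 = "subtopology C1 (manifold_interior n C1)"
  let ?Z0 = "open_cylinder C0 (manifold_boundary n C0)" and ?Z1 = "open_cylinder C1 (manifold_boundary n C1)"
  have h: "?I0 homeomorphic_space ?Z0" "?I1 homeomorphic_space ?Z1"
    using assms by (auto intro: manifold_interior_homeomorphic_open_cylinder)
  then have h': "?Z0 homeomorphic_space ?I0" "?Z1 homeomorphic_space ?I1"
    using homeomorphic_space_sym by blast+
  have "Hausdorff_space C0" "Hausdorff_space C1"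
    using assms by (auto simp: topological_manifold_def)
  then have "properly_homotopy_equivalent_space ?Z0 ?Z1 \<longleftrightarrow>
      subtopology C0 (manifold_boundary n C0) homotopy_equivalent_space
        subtopology C1 (manifold_boundary n C1)"
    using open_cylinders_properly_homotopy_equivalent[OF assms(3) _ assms(4,5)
        closedin_manifold_boundary assms(7) _ assms(8,9) closedin_manifold_boundary]
      open_cylinder_ends_homotopy_equivalent[OF assms(3) closedin_manifold_boundary
        assms(7) closedin_manifold_boundary]
    by blast
  then show ?thesis
    using properly_homotopy_equivalent_space_homeomorphic[OF h]
      properly_homotopy_equivalent_space_homeomorphic[OF h'] by blast
qed

end
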